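(* Let $\phi$ be a non-constant analytic map of $\mathbb{D}$ into $\mathbb{D}$. Then $\phi$ is a finite Blaschke product if and only if there exist $\alpha>0$ with $\alpha\neq 1$ and $c>0$ such that $\tau_{\phi,\alpha}$ is bounded on $\mathbb{D}$ and such that for (Lebesgue) almost every $\zeta\in\partial\mathbb{D}$ $$\angle\liminf_{z\to\zeta}\tau_{\phi,\alpha}(z)\ \ge\ c.$$
   Context: $\mathbb{D}$ is the open unit disk in $\mathbb{C}$. For a non-constant analytic $\phi:\mathbb{D}\to\mathbb{D}$ and $\alpha>0$, the local $\alpha$-hyperbolic distortion is $$\tau_{\phi,\alpha}(z)=\frac{(1-|z|^2)^{\alpha}|\phi'(z)|}{(1-|\phi(z)|^2)^{\alpha}},\qquad z\in\mathbb{D}.$$ For $\zeta\in\partial\mathbb{D}$ and $\gamma>1$ the angular (non-tangential) region is $\Gamma_\gamma(\zeta)=\{z\in\mathbb{D}:|\zeta-z|\le\gamma(1-|z|^2)\}$. For a function $f$ on $\mathbb{D}$, $\angle\liminf_{z\to\zeta}f(z)\ge c$ means that for every $\gamma>1$, $\liminf f(z)\ge c$ as $z\to\zeta$ with $z\in\Gamma_\gamma(\zeta)$; angular limits $\angle\lim_{z\to\zeta}$ are defined analogously (limit along every $\Gamma_\gamma(\zeta)$, $\gamma>1$). *)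

theory Defs
  imports "HOL-Analysis.Analysis"
begin

definition hyp_distortion :: "(complex \<Rightarrow> complex) \<Rightarrow> real \<Rightarrow> complex \<Rightarrow> real" where
  "hyp_distortion \<phi> \<alpha> z =
     (1 - (cmod z)\<^sup>2) powr \<alpha> * cmod (deriv \<phi> z) / (1 - (cmod (\<phi> z))\<^sup>2) powr \<alpha>"

definition angular_region :: "real \<Rightarrow> complex \<Rightarrow> complex set" where
  "angular_region \<gamma> \<zeta> = {z \<in> ball 0 1. cmod (\<zeta> - z) \<le> \<gamma> * (1 - (cmod z)\<^sup>2)}"

definition angular_liminf_ge :: "(complex \<Rightarrow> real) \<Rightarrow> complex \<Rightarrow> real \<Rightarrow> bool" where
  "angular_liminf_ge f \<zeta> c \<longleftrightarrow>
     (\<forall>\<gamma>>1. Liminf (at \<zeta> within angular_region \<gamma> \<zeta>) (\<lambda>z. ereal (f z)) \<ge> ereal c)"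

definition finite_blaschke :: "(complex \<Rightarrow> complex) \<Rightarrow> bool" where
  "finite_blaschke \<phi> \<longleftrightarrow>
     (\<exists>(u::complex) (as::complex list). cmod u = 1 \<and> (\<forall>a\<in>set as. a \<in> ball 0 1) \<and>
        (\<forall>z\<in>ball 0 1. \<phi> z = u * prod_list (map (\<lambda>a. (z - a) / (1 - cnj a * z)) as)))"

end

theory Submission
  imports Defs "HOL-Complex_Analysis.Complex_Analysis"
begin

text \<open>
  Each direction compares \<open>1 - cmod (\<phi> z)\<close> with \<open>1 - cmod z\<close>. For a finite Blaschke product the two
  quantities are comparable and \<open>\<phi>'\<close> is bounded, and bounded away from zero near the circle, so every
  exponent works. Conversely, it suffices to prove that \<open>cmod (\<phi> z) \<longlongrightarrow> 1\<close> uniformly at the circle: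
  dividing out the finitely many zeros then leaves a unimodular constant by the maximum principle.

  For \<open>\<alpha> > 1\<close>, the lower bound on the distortion and the infinitesimal Schwarz-Pick inequality give
  \<open>1 - (cmod (\<phi> w))\<^sup>2 \<le> C (1 - (cmod w)\<^sup>2)\<close> along radii ending in a dense set. Letting \<open>w\<close> tend to
  \<open>z / cmod z\<close> in the two-point Schwarz-Pick inequality (Julia's lemma) yields
  \<open>1 - cmod (\<phi> z) \<le> 2 C (1 - cmod z)\<close> throughout the disc.

  For \<open>\<alpha> < 1\<close>, boundedness of the distortion makes \<open>\<phi>\<close> uniformly continuous. If \<open>cmod \<phi>\<close> did not tend
  to 1, it would stay away from 1 near some boundary arc, where then \<open>cmod (\<phi>' z)\<close> is comparable to
  \<open>(1 - cmod z) powr (- \<alpha>)\<close> in cones over almost every boundary point. Over an interval almost filled by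
  points with uniform cones, \<open>\<phi>'\<close> has no zeros in a rectangle that almost reaches the boundary, and
  harmonic measure (here: an explicit comparison function) forces the large values of \<open>ln (cmod \<phi>')\<close> on
  the bottom side to show up in the middle, contradicting the upper bound.
\<close>

section \<open>The Schwarz-Pick lemma\<close>

lemma norm_one_minus_cnj_mult_diff:
  "(cmod (1 - cnj w * z))\<^sup>2 - (cmod (z - w))\<^sup>2 = (1 - (cmod w)\<^sup>2) * (1 - (cmod z)\<^sup>2)"
  unfolding cmod_power2 by (simp add: algebra_simps power2_eq_square)

lemma one_minus_cnj_mult_nonzero:
  assumes "cmod w < 1" "cmod z \<le> 1"
  shows "1 - cnj w * z \<noteq> 0"
proof
  assume "1 - cnj w * z = 0"
  then have "cmod (cnj w * z) = 1" by simp
  moreover have "cmod w * cmod z < 1"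
    using assms by (metis mult_left_le norm_ge_zero order_le_less_trans)
  ultimately show False by (simp add: norm_mult)
qed

lemma one_minus_norm_Moebius_function:
  assumes "cmod w < 1" "cmod z \<le> 1"
  shows "1 - (cmod (Moebius_function 0 w z))\<^sup>2 =
           (1 - (cmod w)\<^sup>2) * (1 - (cmod z)\<^sup>2) / (cmod (1 - cnj w * z))\<^sup>2"
  using one_minus_cnj_mult_nonzero[OF assms] norm_one_minus_cnj_mult_diff[of w z]
  by (simp add: Moebius_function_simple norm_divide power_divide field_simps)

text \<open>Disc automorphisms carrying \<open>w\<close> and \<open>f w\<close> to 0 turn
  \<open>f\<close> into a self-map fixing 0. The Schwarz lemma is applied to that map at the point
  \<open>?M w z\<close>, which \<open>?M (- w)\<close> sends back to \<open>z\<close>.\<close>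

lemma Schwarz_Pick_Moebius:
  assumes hol: "f holomorphic_on ball 0 1" and maps: "f ` ball 0 1 \<subseteq> ball 0 1"
    and w: "cmod w < 1" and z: "cmod z < 1"
  shows "cmod (Moebius_function 0 (f w) (f z)) \<le> cmod (Moebius_function 0 w z)"
proof -
  let ?M = "Moebius_function 0"
  define h where "h = ?M (f w) \<circ> (f \<circ> ?M (- w))"
  have fb: "cmod (f x) < 1" if "cmod x < 1" for x
    using maps that by (auto simp: image_subset_iff)
  have w': "cmod (- w) < 1" using w by simp
  have Mb: "cmod (?M (- w) x) < 1" if "cmod x < 1" for x
    using Moebius_function_norm_lt_1[OF w' that] .
  have "f \<circ> ?M (- w) holomorphic_on ball 0 1"
    using Mb by (intro holomorphic_on_compose_gen[OF Moebius_function_holomorphic[OF w'] hol]) auto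
  then have holh: "h holomorphic_on ball 0 1"
    unfolding h_def using Mb fb
    by (intro holomorphic_on_compose_gen[OF _ Moebius_function_holomorphic[OF fb[OF w]]]) auto
  have h0: "h 0 = 0"
    by (simp add: h_def Moebius_function_of_zero Moebius_function_eq_zero)
  have hb: "cmod (h x) < 1" if "cmod x < 1" for x
    unfolding h_def o_def using Moebius_function_norm_lt_1 fb Mb that w by simp
  have "cmod (h (?M w z)) \<le> cmod (?M w z)"
    by (intro Schwarz_Lemma(1)[OF holh h0 hb]) (use Moebius_function_norm_lt_1 w z in auto)
  moreover have "?M (- w) (?M w z) = z"
    using Moebius_function_compose[of "- w" w z] w z by simp
  ultimately show ?thesis by (simp add: h_def)
qed

text \<open>Obtained from the Moebius form by squaring and subtracting from 1. In this shape
  \<open>1 - (cmod w)\<^sup>2\<close> is an explicit factor, which can be cancelled while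
  \<open>w\<close> approaches the circle.\<close>

lemma Schwarz_Pick:
  assumes hol: "f holomorphic_on ball 0 1" and maps: "f ` ball 0 1 \<subseteq> ball 0 1"
    and w: "cmod w < 1" and z: "cmod z < 1"
  shows "(1 - (cmod w)\<^sup>2) * (1 - (cmod z)\<^sup>2) / (cmod (1 - cnj w * z))\<^sup>2 \<le>
         (1 - (cmod (f w))\<^sup>2) * (1 - (cmod (f z))\<^sup>2) / (cmod (1 - cnj (f w) * f z))\<^sup>2"
proof -
  have "cmod (f w) < 1" "cmod (f z) < 1"
    using maps w z by (auto simp: image_subset_iff)
  then have "(1 - (cmod w)\<^sup>2) * (1 - (cmod z)\<^sup>2) / (cmod (1 - cnj w * z))\<^sup>2 =
        1 - (cmod (Moebius_function 0 w z))\<^sup>2"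
      "(1 - (cmod (f w))\<^sup>2) * (1 - (cmod (f z))\<^sup>2) / (cmod (1 - cnj (f w) * f z))\<^sup>2 =
        1 - (cmod (Moebius_function 0 (f w) (f z)))\<^sup>2"
    using one_minus_norm_Moebius_function w z by simp_all
  moreover have "(cmod (Moebius_function 0 (f w) (f z)))\<^sup>2 \<le> (cmod (Moebius_function 0 w z))\<^sup>2"
    by (intro power_mono Schwarz_Pick_Moebius assms) simp
  ultimately show ?thesis by linarith
qed

text \<open>The infinitesimal form: divide the Moebius inequality by \<open>cmod (z - w)\<close> and
  let \<open>z\<close> tend to \<open>w\<close>.\<close>

lemma Schwarz_Pick_deriv:
  assumes hol: "f holomorphic_on ball 0 1" and maps: "f ` ball 0 1 \<subseteq> ball 0 1"
    and w: "cmod w < 1"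
  shows "(1 - (cmod w)\<^sup>2) * cmod (deriv f w) \<le> 1 - (cmod (f w))\<^sup>2"
proof -
  have fb: "cmod (f x) < 1" if "cmod x < 1" for x
    using maps that by (auto simp: image_subset_iff)
  have df: "(f has_field_derivative deriv f w) (at w)"
    using hol w by (intro holomorphic_derivI[of _ "ball 0 1"]) auto
  have cf: "f \<midarrow>w\<rightarrow> f w"
    using DERIV_isCont[OF df] by (simp add: isCont_def)
  have q: "((\<lambda>z. (f z - f w) / (z - w)) \<longlongrightarrow> deriv f w) (at w)"
    using df by (simp add: has_field_derivative_iff)
  have l1: "((\<lambda>z. cmod ((f z - f w) / (z - w)) * cmod (1 - cnj w * z)) \<longlongrightarrow>
      cmod (deriv f w) * cmod (1 - cnj w * w)) (at w)"
    by (intro tendsto_intros q)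
  have l2: "((\<lambda>z. cmod (1 - cnj (f w) * f z)) \<longlongrightarrow> cmod (1 - cnj (f w) * f w)) (at w)"
    by (intro tendsto_intros cf)
  have ev: "eventually (\<lambda>z. cmod z < 1) (at w)"
    using w eventually_at_in_open'[of "ball 0 1" w] by simp
  have "cmod (deriv f w) * cmod (1 - cnj w * w) \<le> cmod (1 - cnj (f w) * f w)"
  proof (rule tendsto_le[OF _ l2 l1])
    show "eventually (\<lambda>z. cmod ((f z - f w) / (z - w)) * cmod (1 - cnj w * z) \<le> cmod (1 - cnj (f w) * f z)) (at w)"
      using ev eventually_neq_at_within[of w]
    proof eventually_elim
      case (elim z)
      have n: "1 - cnj w * z \<noteq> 0" "1 - cnj (f w) * f z \<noteq> 0"
        using one_minus_cnj_mult_nonzero w elim fb by (auto simp: less_imp_le)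
      show ?case using Schwarz_Pick_Moebius[OF hol maps w, of z] elim n
        by (simp add: Moebius_function_simple norm_divide field_simps)
    qed
  qed simp
  moreover have eq: "cmod (1 - cnj x * x) = 1 - (cmod x)\<^sup>2" if "cmod x < 1" for x
  proof -
    have "1 - cnj x * x = of_real (1 - (cmod x)\<^sup>2)"
      by (metis complex_norm_square mult.commute of_real_1 of_real_diff)
    moreover have "1 - (cmod x)\<^sup>2 \<ge> 0" using that by (simp add: power_le_one)
    ultimately show ?thesis by (metis norm_of_real abs_of_nonneg)
  qed
  ultimately show ?thesis using w fb[OF w] by (simp add: mult.commute)
qed

section \<open>Finite Blaschke products\<close>

text \<open>Approach to the circle from inside, uniformly in the argument: an eventual property
  holds on a full annulus \<open>r < cmod z < 1\<close>.\<close>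

abbreviation at_unit_circle :: "complex filter" where
  "at_unit_circle \<equiv> filtercomap cmod (at_left 1)"

lemma eventually_at_unit_circle:
  "eventually P at_unit_circle \<longleftrightarrow> (\<exists>r<1. \<forall>z. r < cmod z \<and> cmod z < 1 \<longrightarrow> P z)"
proof
  assume "eventually P at_unit_circle"
  then obtain Q where Q: "eventually Q (at_left (1::real))" "\<And>z. Q (cmod z) \<Longrightarrow> P z"
    by (auto simp: eventually_filtercomap)
  then obtain r where "r < 1" "\<And>y. r < y \<Longrightarrow> y < 1 \<Longrightarrow> Q y"
    by (auto simp: eventually_at_left_field)
  then show "\<exists>r<1. \<forall>z. r < cmod z \<and> cmod z < 1 \<longrightarrow> P z"
    using Q(2) by blast
next
  assume "\<exists>r<1. \<forall>z. r < cmod z \<and> cmod z < 1 \<longrightarrow> P z"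
  then obtain r where r: "r < 1" "\<forall>z. r < cmod z \<and> cmod z < 1 \<longrightarrow> P z" by blast
  have "eventually (\<lambda>x. r < x \<and> x < 1) (at_left (1::real))"
    using r(1) by (auto simp: eventually_at_left_field)
  then show "eventually P at_unit_circle"
    using r(2) by (auto simp: eventually_filtercomap)
qed

lemma tendsto_norm_at_unit_circle: "(cmod \<longlongrightarrow> 1) at_unit_circle"
  using filterlim_filtercomap[of cmod "at_left 1"] by (simp add: filterlim_at)

text \<open>In the identity for 1 minus the squared modulus the denominator is at least
  \<open>(1 - cmod a)\<^sup>2\<close>, so the quotient vanishes at the circle together with
  \<open>1 - (cmod z)\<^sup>2\<close>.\<close>

lemma tendsto_norm_Moebius_at_unit_circle:
  assumes a: "cmod a < 1"
  shows "((\<lambda>z. cmod (Moebius_function 0 a z)) \<longlongrightarrow> 1) at_unit_circle"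
proof -
  have ev: "eventually (\<lambda>z. cmod z < 1) at_unit_circle"
    by (auto simp: eventually_at_unit_circle intro: exI[of _ 0])
  have "((\<lambda>z. 1 - (cmod (Moebius_function 0 a z))\<^sup>2) \<longlongrightarrow> 0) at_unit_circle"
  proof (rule tendsto_sandwich[where f = "\<lambda>_. 0"])
    show "((\<lambda>z. (1 - (cmod a)\<^sup>2) * (1 - (cmod z)\<^sup>2) / (1 - cmod a)\<^sup>2) \<longlongrightarrow> 0) at_unit_circle"
    proof -
      have "((\<lambda>z. (1 - (cmod a)\<^sup>2) * (1 - (cmod z)\<^sup>2) / (1 - cmod a)\<^sup>2) \<longlongrightarrow>
          (1 - (cmod a)\<^sup>2) * (1 - 1\<^sup>2) / (1 - cmod a)\<^sup>2) at_unit_circle"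
        using a by (intro tendsto_divide tendsto_mult tendsto_diff tendsto_power
            tendsto_norm_at_unit_circle tendsto_const) auto
      then show ?thesis by simp
    qed
    show "eventually (\<lambda>z. 0 \<le> 1 - (cmod (Moebius_function 0 a z))\<^sup>2) at_unit_circle"
      using ev
    proof eventually_elim
      case (elim z)
      then show ?case using Moebius_function_norm_lt_1[OF a, of z 0] by (simp add: power_le_one)
    qed
    show "eventually (\<lambda>z. 1 - (cmod (Moebius_function 0 a z))\<^sup>2 \<le>
        (1 - (cmod a)\<^sup>2) * (1 - (cmod z)\<^sup>2) / (1 - cmod a)\<^sup>2) at_unit_circle"
      using ev
    proof eventually_elim
      case (elim z)
      have "cmod (cnj a * z) \<le> cmod a"
        using elim by (simp add: norm_mult mult_left_le)
      then have "1 - cmod a \<le> cmod (1 - cnj a * z)"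
        using norm_triangle_ineq2[of 1 "cnj a * z"] by simp
      then have "(1 - cmod a)\<^sup>2 \<le> (cmod (1 - cnj a * z))\<^sup>2"
        using a by (intro power_mono) auto
      moreover have "(1 - (cmod a)\<^sup>2) * (1 - (cmod z)\<^sup>2) \<ge> 0"
        using a elim by (simp add: power_le_one)
      moreover have "0 < (cmod (1 - cnj a * z))\<^sup>2 * (1 - cmod a)\<^sup>2"
        using a elim one_minus_cnj_mult_nonzero[of a z] by simp
      ultimately show ?case
        using a elim by (subst one_minus_norm_Moebius_function) (auto intro!: divide_left_mono)
    qed
  qed auto
  from tendsto_diff[OF tendsto_const[of 1] this]
  have "((\<lambda>z. sqrt ((cmod (Moebius_function 0 a z))\<^sup>2)) \<longlongrightarrow> sqrt 1) at_unit_circle"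
    by (intro tendsto_real_sqrt) simp
  then show ?thesis by simp
qed

section \<open>From modulus one at the circle to a finite Blaschke product\<close>

lemma norm_le_1_of_tendsto_at_unit_circle:
  assumes hol: "f holomorphic_on ball 0 1" and lim: "((\<lambda>z. cmod (f z)) \<longlongrightarrow> 1) at_unit_circle"
    and z: "cmod z < 1"
  shows "cmod (f z) \<le> 1"
proof (rule field_le_epsilon)
  fix e :: real assume "e > 0"
  then have "eventually (\<lambda>z. cmod (f z) < 1 + e) at_unit_circle"
    using lim by (intro order_tendstoD) auto
  then obtain r where r: "r < 1" "\<And>z. r < cmod z \<Longrightarrow> cmod z < 1 \<Longrightarrow> cmod (f z) < 1 + e"
    by (auto simp: eventually_at_unit_circle)
  \<comment> \<open>The circle of radius \<open>s\<close> encloses \<open>z\<close> and lies in the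
    annulus where \<open>1 + e\<close> is a bound, so the maximum principle applies on
    \<open>ball 0 s\<close>.\<close>
  obtain s where s: "max r (cmod z) < s" "s < 1"
    using dense[of "max r (cmod z)" 1] r z by auto
  have s0: "s > 0" using s norm_ge_zero[of z] by linarith
  show "cmod (f z) \<le> 1 + e"
  proof (rule maximum_modulus_frontier[of f "ball 0 s"])
    show "f holomorphic_on interior (ball 0 s)" "continuous_on (closure (ball 0 s)) f"
      using s s0 by (auto intro!: holomorphic_on_subset[OF hol] holomorphic_on_imp_continuous_on)
    show "cmod (f x) \<le> 1 + e" if "x \<in> frontier (ball 0 s)" for x
      using that s s0 r(2)[of x] by auto
  qed (use s in auto)
qed

lemma prod_list_replicate_Moebius:
  "prod_list (map (\<lambda>a. Moebius_function 0 a z) (replicate n a)) = Moebius_function 0 a z ^ n"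
  by (induction n) auto

lemma finite_blaschke_alt:
  "finite_blaschke f \<longleftrightarrow> (\<exists>u as. cmod u = 1 \<and> (\<forall>a\<in>set as. cmod a < 1) \<and>
     (\<forall>z\<in>ball 0 1. f z = u * prod_list (map (\<lambda>a. Moebius_function 0 a z) as)))"
  unfolding finite_blaschke_def Moebius_function_simple by simp

lemma finite_blaschke_mult_Moebius_power:
  assumes g: "finite_blaschke g" and a: "cmod a < 1"
    and f: "\<And>z. z \<in> ball 0 1 \<Longrightarrow> f z = Moebius_function 0 a z ^ n * g z"
  shows "finite_blaschke f"
proof -
  obtain u as where *: "cmod u = 1" "\<forall>a\<in>set as. cmod a < 1"
    "\<And>z. z\<in>ball 0 1 \<Longrightarrow> g z = u * prod_list (map (\<lambda>a. Moebius_function 0 a z) as)"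
    using g unfolding finite_blaschke_alt by blast
  have "f z = u * prod_list (map (\<lambda>a. Moebius_function 0 a z) (replicate n a @ as))"
    if "z \<in> ball 0 1" for z
    unfolding map_append prod_list.append prod_list_replicate_Moebius f[OF that] *(3)[OF that]
    by simp
  moreover have "\<forall>x\<in>set (replicate n a @ as). cmod x < 1"
    using * a by auto
  ultimately show ?thesis unfolding finite_blaschke_alt using *(1) by blast
qed

text \<open>Both \<open>f\<close> and its reciprocal have modulus at most 1, so \<open>f\<close> has
  constant modulus 1 and is constant by the maximum principle. This is the empty product.\<close>

lemma finite_blaschke_if_no_zeros:
  assumes hol: "f holomorphic_on ball 0 1" and lim: "((\<lambda>z. cmod (f z)) \<longlongrightarrow> 1) at_unit_circle"
    and nz: "\<And>z. z \<in> ball 0 1 \<Longrightarrow> f z \<noteq> 0"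
  shows "finite_blaschke f"
proof -
  have le: "cmod (f z) \<le> 1" if "cmod z < 1" for z
    using norm_le_1_of_tendsto_at_unit_circle[OF hol lim that] .
  have "((\<lambda>z. cmod (inverse (f z))) \<longlongrightarrow> 1) at_unit_circle"
    using tendsto_inverse[OF lim] by (simp add: norm_inverse)
  moreover have "(\<lambda>z. inverse (f z)) holomorphic_on ball 0 1"
    using hol nz by (intro holomorphic_intros) auto
  ultimately have "cmod (inverse (f z)) \<le> 1" if "cmod z < 1" for z
    using norm_le_1_of_tendsto_at_unit_circle that by blast
  then have ge: "cmod (f z) \<ge> 1" if "cmod z < 1" for z
    using that nz[of z] by (metis inverse_le_1_iff less_le_not_le mem_ball_0 norm_inverse
        norm_le_zero_iff not_le)
  have "f constant_on ball 0 1"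
    by (rule maximum_modulus_principle[OF hol _ _ open_ball subset_refl, of 0])
       (use le ge in \<open>auto intro: order_trans[OF le ge]\<close>)
  then obtain u where u: "\<And>z. z \<in> ball 0 1 \<Longrightarrow> f z = u"
    by (auto simp: constant_on_def)
  have "cmod u = 1" using le[of 0] ge[of 0] u[of 0] by auto
  then show ?thesis unfolding finite_blaschke_alt
    using u by (intro exI[of _ u] exI[of _ "[]"]) auto
qed

text \<open>Induction on the set of distinct zeros: dividing by the Moebius factor at one zero,
  raised to its multiplicity, removes that zero and preserves the boundary limit, since such factors
  have modulus tending to 1.\<close>

lemma finite_blaschke_if_finite_zeros:
  assumes "finite Z" "f holomorphic_on ball 0 1"
    and "((\<lambda>z. cmod (f z)) \<longlongrightarrow> 1) at_unit_circle" "{z \<in> ball 0 1. f z = 0} = Z"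
  shows "finite_blaschke f"
  using assms
proof (induction Z arbitrary: f rule: finite_induct)
  case empty
  then show ?case using finite_blaschke_if_no_zeros by blast
next
  case (insert a Z f)
  note hol = insert.prems(1) and lim = insert.prems(2) and zs = insert.prems(3)
  have a: "a \<in> ball 0 1" "f a = 0" using zs by auto
  then have a1: "cmod a < 1" by simp
  have "\<not> f constant_on ball 0 1"
  proof
    assume "f constant_on ball 0 1"
    then have "f z = 0" if "z \<in> ball 0 1" for z
      using a that by (metis constant_on_def)
    then have "ball 0 1 = insert a Z" using zs by auto
    then have "finite (ball (0::complex) 1)" using insert.hyps by (metis finite_insert)
    then show False using finite_imp_not_open[of "ball (0::complex) 1"] by simp
  qed
  then obtain g r n where gr: "0 < (n::nat)" "0 < r" "ball a r \<subseteq> ball 0 1"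
      "g holomorphic_on ball a r"
      "\<And>w. w \<in> ball a r \<Longrightarrow> f w = (w - a) ^ n * g w" "\<And>w. w \<in> ball a r \<Longrightarrow> g w \<noteq> 0"
    using holomorphic_factor_zero_nonconstant[OF hol open_ball connected_ball a] by metis
  \<comment> \<open>\<open>G\<close> is \<open>f\<close> divided by the \<open>n\<close>-th power of
    the Moebius factor, with the removable singularity at \<open>a\<close> filled by the local
    factor \<open>g\<close>.\<close>
  define G where "G z = (1 - cnj a * z) ^ n * (if z = a then g a else f z / (z - a) ^ n)" for z
  have nz: "1 - cnj a * z \<noteq> 0" if "z \<in> ball 0 1" for z
    using one_minus_cnj_mult_nonzero a1 that by simp
  have eqG: "f z = Moebius_function 0 a z ^ n * G z" if "z \<in> ball 0 1" for z
    using nz[OF that] a gr(1) by (auto simp: G_def Moebius_function_simple power_divide)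
  have "G holomorphic_on ball a r \<union> (ball 0 1 - {a})"
  proof (rule holomorphic_on_Un)
    have "(\<lambda>z. (1 - cnj a * z) ^ n * g z) holomorphic_on ball a r"
      by (intro holomorphic_intros gr)
    then show "G holomorphic_on ball a r"
      by (rule holomorphic_transform) (auto simp: G_def gr(5))
    have "(\<lambda>z. (1 - cnj a * z) ^ n * (f z / (z - a) ^ n)) holomorphic_on ball 0 1 - {a}"
      using hol by (intro holomorphic_intros) (auto elim: holomorphic_on_subset)
    then show "G holomorphic_on ball 0 1 - {a}"
      by (rule holomorphic_transform) (auto simp: G_def)
  qed auto
  moreover have "ball a r \<union> (ball 0 1 - {a}) = ball 0 1"
    using gr(2,3) a by auto
  ultimately have holG: "G holomorphic_on ball 0 1" by simp
  have "((\<lambda>z. cmod (f z) / cmod (Moebius_function 0 a z) ^ n) \<longlongrightarrow> 1 / 1 ^ n) at_unit_circle"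
    by (intro tendsto_intros lim tendsto_norm_Moebius_at_unit_circle a1) auto
  moreover have "eventually (\<lambda>z. cmod (f z) / cmod (Moebius_function 0 a z) ^ n = cmod (G z)) at_unit_circle"
    unfolding eventually_at_unit_circle
  proof (intro exI[of _ "cmod a"] conjI a1 allI impI)
    fix z assume z: "cmod a < cmod z \<and> cmod z < 1"
    then have "Moebius_function 0 a z \<noteq> 0"
      using nz[of z] by (auto simp: Moebius_function_simple)
    then show "cmod (f z) / cmod (Moebius_function 0 a z) ^ n = cmod (G z)"
      using eqG[of z] z by (simp add: norm_mult norm_power)
  qed
  ultimately have limG: "((\<lambda>z. cmod (G z)) \<longlongrightarrow> 1) at_unit_circle"
    using Lim_transform_eventually by force
  have "{z \<in> ball 0 1. G z = 0} = Z"
  proof -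
    have "G a \<noteq> 0" using gr(2,6) nz a by (simp add: G_def)
    moreover have "G z = 0 \<longleftrightarrow> f z = 0" if "z \<in> ball 0 1" "z \<noteq> a" for z
      using nz[of z] that by (auto simp: G_def)
    ultimately have "{z \<in> ball 0 1. G z = 0} = {z \<in> ball 0 1. f z = 0} - {a}"
      by (intro set_eqI) (metis (mono_tags, lifting) DiffI DiffE insertI1 mem_Collect_eq singletonD)
    then show ?thesis using zs insert.hyps(2) by simp
  qed
  then have "finite_blaschke G" using insert.IH holG limG by blast
  then show ?case using finite_blaschke_mult_Moebius_power[OF _ a1 eqG] by blast
qed

text \<open>The limit keeps all zeros inside a compact disc, where a nonconstant holomorphic
  function has only finitely many. A constant \<open>f\<close> has none.\<close>

lemma finite_blaschke_if_tendsto_at_unit_circle: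
  assumes hol: "f holomorphic_on ball 0 1" and lim: "((\<lambda>z. cmod (f z)) \<longlongrightarrow> 1) at_unit_circle"
  shows "finite_blaschke f"
proof (rule finite_blaschke_if_finite_zeros[OF _ hol lim refl])
  have "eventually (\<lambda>z. cmod (f z) > 0) at_unit_circle"
    using lim by (intro order_tendstoD) auto
  then obtain r where r: "r < 1" "\<And>z. r < cmod z \<Longrightarrow> cmod z < 1 \<Longrightarrow> f z \<noteq> 0"
    by (auto simp: eventually_at_unit_circle)
  show "finite {z \<in> ball 0 1. f z = 0}"
  proof (cases "f constant_on ball 0 1")
    case True
    then obtain u where u: "\<And>z. z \<in> ball 0 1 \<Longrightarrow> f z = u"
      by (auto simp: constant_on_def)
    obtain s where "max r 0 < s" "s < 1" using dense[of "max r 0" 1] r(1) by auto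
    then have "u \<noteq> 0" using r(2)[of "of_real s"] u[of "of_real s"] by simp
    then have "{z \<in> ball 0 1. f z = 0} = {}" using u by blast
    then show ?thesis by (metis finite.emptyI)
  next
    case nc: False
    have "finite {z \<in> cball 0 r. f z = 0}"
      by (rule holomorphic_compact_finite_zeros[OF hol _ _ _ _ nc]) (use r in auto)
    moreover have "{z \<in> ball 0 1. f z = 0} \<subseteq> {z \<in> cball 0 r. f z = 0}"
      using r(2) by force
    ultimately show ?thesis using finite_subset by blast
  qed
qed

section \<open>Boundary behaviour and distortion of finite Blaschke products\<close>

lemma blaschke_product_holomorphic:
  assumes "\<forall>a\<in>set as. cmod a < 1"
  obtains U where "open U" "cball 0 1 \<subseteq> U"
    "(\<lambda>z. prod_list (map (\<lambda>a. Moebius_function 0 a z) as)) holomorphic_on U"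
proof -
  define U where "U = (\<Inter>a\<in>set as. {z. 1 - cnj a * z \<noteq> 0})"
  have "open {z. 1 - cnj a * z \<noteq> 0}" for a
    by (intro open_Collect_neq continuous_intros)
  then have "open U" unfolding U_def by (intro open_INT) auto
  moreover have "cball 0 1 \<subseteq> U"
    using assms one_minus_cnj_mult_nonzero by (auto simp: U_def)
  \<comment> \<open>\<open>U\<close> depends on \<open>as\<close>, so the induction runs over lists
    \<open>bs\<close> with entries in \<open>set as\<close> and leaves \<open>U\<close>
    fixed.\<close>
  moreover have "(\<lambda>z. prod_list (map (\<lambda>a. Moebius_function 0 a z) bs)) holomorphic_on U"
    if "set bs \<subseteq> set as" for bs
    using that
  proof (induction bs)
    case (Cons b bs)
    have "(\<lambda>z. Moebius_function 0 b z) holomorphic_on U"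
      unfolding Moebius_function_simple using Cons.prems
      by (intro holomorphic_intros) (auto simp: U_def)
    then show ?case using Cons by (auto intro!: holomorphic_intros)
  qed auto
  ultimately show ?thesis using that by blast
qed

lemma norm_blaschke_product_unit_circle:
  assumes "\<forall>a\<in>set as. cmod a < 1" and z: "cmod z = 1"
  shows "cmod (prod_list (map (\<lambda>a. Moebius_function 0 a z) as)) = 1"
  using assms(1)
proof (induction as)
  case (Cons a as)
  have "(cmod (Moebius_function 0 a z))\<^sup>2 = 1"
    using one_minus_norm_Moebius_function[of a z] Cons.prems z by simp
  then have "cmod (Moebius_function 0 a z) = 1"
    using power2_eq_1_iff norm_ge_zero by (smt (verit))
  then show ?case using Cons by (simp add: norm_mult)
qed auto

text \<open>Schwarz-Pick with one of the two points at the origin, the denominator being at least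
  \<open>(1 - cmod (f 0))\<^sup>2\<close>.\<close>

lemma one_minus_norm_lower_bound:
  assumes hol: "f holomorphic_on ball 0 1" and maps: "f ` ball 0 1 \<subseteq> ball 0 1"
    and z: "cmod z < 1"
  shows "(1 - cmod (f 0))\<^sup>2 * (1 - (cmod z)\<^sup>2) \<le> 1 - (cmod (f z))\<^sup>2"
proof -
  have f1: "cmod (f 0) < 1" "cmod (f z) < 1"
    using maps z by (auto simp: image_subset_iff)
  have "cmod (cnj (f 0) * f z) \<le> cmod (f 0)"
    using f1 by (simp add: norm_mult mult_left_le)
  then have "1 - cmod (f 0) \<le> cmod (1 - cnj (f 0) * f z)"
    using norm_triangle_ineq2[of 1 "cnj (f 0) * f z"] by simp
  then have d: "(1 - cmod (f 0))\<^sup>2 \<le> (cmod (1 - cnj (f 0) * f z))\<^sup>2"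
    using f1 by (intro power_mono) auto
  have pos: "0 < (1 - cmod (f 0))\<^sup>2" using f1 by simp
  have n: "0 \<le> 1 - (cmod (f z))\<^sup>2" using f1 by (simp add: power_le_one)
  have "1 - (cmod z)\<^sup>2 \<le> (1 - (cmod (f 0))\<^sup>2) * (1 - (cmod (f z))\<^sup>2) / (cmod (1 - cnj (f 0) * f z))\<^sup>2"
    using Schwarz_Pick[OF hol maps, of 0 z] z by simp
  also have "\<dots> \<le> 1 * (1 - (cmod (f z))\<^sup>2) / (1 - cmod (f 0))\<^sup>2"
    using d pos n by (intro frac_le mult_right_mono mult_nonneg_nonneg) auto
  finally show ?thesis using pos by (simp add: field_simps)
qed

text \<open>With exponent 2 the distortion is the squared quotient of
  \<open>1 - (cmod z)\<^sup>2\<close> by \<open>1 - (cmod (\<phi> z))\<^sup>2\<close>, times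
  \<open>cmod (deriv B z)\<close>. Two-sided bounds for the quotient and for the derivative near the
  circle give both claims.\<close>

lemma hyp_distortion_if_finite_blaschke:
  assumes hol: "\<phi> holomorphic_on ball 0 1" and maps: "\<phi> ` ball 0 1 \<subseteq> ball 0 1"
    and bl: "finite_blaschke \<phi>"
  shows "\<exists>c>0. bounded (hyp_distortion \<phi> 2 ` ball 0 1) \<and>
           (\<forall>t. angular_liminf_ge (hyp_distortion \<phi> 2) (cis t) c)"
proof -
  obtain u as where u: "cmod u = 1" and as: "\<forall>a\<in>set as. cmod a < 1" and
    \<phi>: "\<And>z. z\<in>ball 0 1 \<Longrightarrow> \<phi> z = u * prod_list (map (\<lambda>a. Moebius_function 0 a z) as)"
    using bl unfolding finite_blaschke_alt by blast
  \<comment> \<open>\<open>B\<close> extends \<open>\<phi>\<close> holomorphically across the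
    circle, whereas nothing is known about the values of \<open>\<phi>\<close> outside the open
    disc.\<close>
  define B where "B z = u * prod_list (map (\<lambda>a. Moebius_function 0 a z) as)" for z
  obtain U where U: "open U" "cball 0 1 \<subseteq> U" and "(\<lambda>z. prod_list (map (\<lambda>a. Moebius_function 0 a z) as)) holomorphic_on U"
    using blaschke_product_holomorphic[OF as] .
  then have holB: "B holomorphic_on U"
    unfolding B_def by (intro holomorphic_intros)
  have B\<phi>: "B z = \<phi> z" if "cmod z < 1" for z using \<phi> that by (simp add: B_def)
  have B1: "cmod (B z) = 1" if "cmod z = 1" for z
    using norm_blaschke_product_unit_circle[OF as that] u by (simp add: B_def norm_mult)
  have dB: "(B has_field_derivative deriv B z) (at z)" if "cmod z \<le> 1" for z
    using U that by (intro holomorphic_derivI[OF holB]) auto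
  have d\<phi>: "deriv \<phi> z = deriv B z" if "cmod z < 1" for z
  proof (rule complex_derivative_transform_within_open[of _ "ball 0 1"])
    show "B holomorphic_on ball 0 1" using ball_subset_cball holB U(2) holomorphic_on_subset by blast
  qed (use hol B\<phi> that in auto)
  have \<phi>1: "cmod (\<phi> z) < 1" if "cmod z < 1" for z
    using maps that by (auto simp: image_subset_iff)
  have hdB: "deriv B holomorphic_on U" using holB U by (intro holomorphic_deriv)
  then have cdB: "continuous_on (cball 0 1) (deriv B)"
    using U(2) holomorphic_on_imp_continuous_on holomorphic_on_subset by blast
  then have "bounded (deriv B ` cball 0 1)"
    by (intro compact_imp_bounded compact_continuous_image) auto
  then obtain L where L: "L > 0" "\<And>z. cmod z \<le> 1 \<Longrightarrow> cmod (deriv B z) \<le> L"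
    by (auto simp: bounded_pos)
  have lip: "cmod (B x - B y) \<le> L * cmod (x - y)" if "cmod x \<le> 1" "cmod y \<le> 1" for x y
    by (rule field_differentiable_bound[of "cball 0 1" B "deriv B"])
       (use that L(2) has_field_derivative_at_within[OF dB] in auto)
  define \<kappa> where "\<kappa> = (1 - cmod (\<phi> 0))\<^sup>2"
  have \<kappa>: "\<kappa> > 0" using \<phi>1[of 0] by (simp add: \<kappa>_def)
  have lower: "\<kappa> * (1 - (cmod z)\<^sup>2) \<le> 1 - (cmod (\<phi> z))\<^sup>2" if "cmod z < 1" for z
    unfolding \<kappa>_def using one_minus_norm_lower_bound[OF hol maps that] .
  \<comment> \<open>Compare \<open>z\<close> with the nearest boundary point, where \<open>B\<close>
    has modulus 1, by means of the Lipschitz bound. At the origin \<open>sgn\<close> is 0, so the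
    point 1 is taken instead.\<close>
  have upper: "1 - (cmod (\<phi> z))\<^sup>2 \<le> 2 * L * (1 - (cmod z)\<^sup>2)" if z: "cmod z < 1" for z
  proof -
    obtain \<zeta> where \<zeta>: "cmod \<zeta> = 1" "cmod (\<zeta> - z) = 1 - cmod z"
    proof (cases "z = 0")
      case True
      then show ?thesis using that[of 1] by simp
    next
      case False
      have "sgn z - z = of_real (1 - cmod z) * sgn z"
        using False by (simp add: sgn_eq field_simps)
      then have "cmod (sgn z - z) = \<bar>1 - cmod z\<bar> * cmod (sgn z)"
        by (metis norm_mult norm_of_real)
      then show ?thesis using that[of "sgn z"] False z by (simp add: norm_sgn)
    qed
    have "1 - cmod (\<phi> z) \<le> cmod (B \<zeta> - B z)"
      using norm_triangle_ineq2[of "B \<zeta>" "B z"] B1[OF \<zeta>(1)] B\<phi>[OF z] by simp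
    also have "\<dots> \<le> L * (1 - cmod z)" using lip[of \<zeta> z] \<zeta> z by simp
    finally have *: "1 - cmod (\<phi> z) \<le> L * (1 - cmod z)" .
    have "1 - (cmod (\<phi> z))\<^sup>2 = (1 + cmod (\<phi> z)) * (1 - cmod (\<phi> z))"
      by (simp add: power2_eq_square algebra_simps)
    also have "\<dots> \<le> 2 * (L * (1 - cmod z))"
      using * \<phi>1[OF z] by (intro mult_mono) auto
    also have "\<dots> \<le> 2 * L * (1 - (cmod z)\<^sup>2)"
      using L(1) z by (simp add: power2_eq_square mult_left_le)
    finally show ?thesis .
  qed
  have pos: "1 - (cmod z)\<^sup>2 > 0" "1 - (cmod (\<phi> z))\<^sup>2 > 0" if "cmod z < 1" for z
    using that \<phi>1[OF that] by (auto simp: abs_square_less_1)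
  have hd: "hyp_distortion \<phi> 2 z = ((1 - (cmod z)\<^sup>2) / (1 - (cmod (\<phi> z))\<^sup>2))\<^sup>2 * cmod (deriv B z)"
    if "cmod z < 1" for z
    using pos[OF that] d\<phi>[OF that] by (simp add: hyp_distortion_def power_divide)
  have bdd: "bounded (hyp_distortion \<phi> 2 ` ball 0 1)"
  proof (rule boundedI)
    fix y assume "y \<in> hyp_distortion \<phi> 2 ` ball 0 1"
    then obtain z where z: "cmod z < 1" "y = hyp_distortion \<phi> 2 z" by auto
    have "(1 - (cmod z)\<^sup>2) / (1 - (cmod (\<phi> z))\<^sup>2) \<le> 1 / \<kappa>"
      using lower[OF z(1)] pos[OF z(1)] \<kappa> by (simp add: field_simps)
    then have "((1 - (cmod z)\<^sup>2) / (1 - (cmod (\<phi> z))\<^sup>2))\<^sup>2 * cmod (deriv B z) \<le> (1 / \<kappa>)\<^sup>2 * L"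
      using pos[OF z(1)] L(2)[of z] z(1) by (intro mult_mono power_mono) auto
    then show "norm y \<le> (1 / \<kappa>)\<^sup>2 * L"
      using hd[OF z(1)] z(2) by (simp add: abs_mult)
  qed
  text \<open>Hopf's lemma: \<open>1 - cmod (B (r \<zeta>)) \<ge> \<kappa> (1 - r) / 2\<close> bounds the radial difference quotients at
    \<open>\<zeta>\<close> from below.\<close>
  have dB_lower: "\<kappa> / 2 \<le> cmod (deriv B \<zeta>)" if \<zeta>: "cmod \<zeta> = 1" for \<zeta>
  proof -
    have nz: "\<zeta> \<noteq> 0" using \<zeta> by auto
    have q: "((\<lambda>z. (B z - B \<zeta>) / (z - \<zeta>)) \<longlongrightarrow> deriv B \<zeta>) (at \<zeta>)"
      using dB[of \<zeta>] \<zeta> by (simp add: has_field_derivative_iff)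
    have "filterlim (\<lambda>r. of_real r * \<zeta>) (at \<zeta>) (at_left 1)"
    proof (rule filterlim_atI)
      show "((\<lambda>r. of_real r * \<zeta>) \<longlongrightarrow> \<zeta>) (at_left 1)"
        by (auto intro!: tendsto_eq_intros)
      show "eventually (\<lambda>r. of_real r * \<zeta> \<noteq> \<zeta>) (at_left 1)"
        using nz by (auto simp: eventually_at_filter)
    qed
    then have "((\<lambda>r. cmod ((B (of_real r * \<zeta>) - B \<zeta>) / (of_real r * \<zeta> - \<zeta>))) \<longlongrightarrow> cmod (deriv B \<zeta>)) (at_left 1)"
      by (intro tendsto_norm filterlim_compose[OF q])
    moreover have "eventually (\<lambda>r. \<kappa> / 2 \<le> cmod ((B (of_real r * \<zeta>) - B \<zeta>) / (of_real r * \<zeta> - \<zeta>))) (at_left 1)"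
    proof -
      have "eventually (\<lambda>r::real. 0 < r \<and> r < 1) (at_left 1)"
        by (auto simp: eventually_at_left_field intro: exI[of _ 0])
      then show ?thesis
      proof eventually_elim
        case (elim r)
        let ?z = "of_real r * \<zeta>"
        have nr: "cmod ?z = r" using elim \<zeta> by (simp add: norm_mult)
        have z1: "cmod ?z < 1" using nr elim by simp
        have "?z - \<zeta> = of_real (r - 1) * \<zeta>" by (simp add: algebra_simps)
        then have nd: "cmod (?z - \<zeta>) = 1 - r" using elim \<zeta> by (simp only: norm_mult norm_of_real) simp
        have "\<kappa> * (1 - r) \<le> \<kappa> * (1 - r\<^sup>2)"
          using elim \<kappa> by (simp add: power2_eq_square mult_left_le)
        also have "\<dots> \<le> 1 - (cmod (B ?z))\<^sup>2" using lower[OF z1] B\<phi>[OF z1] unfolding nr by simp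
        also have "\<dots> = (1 + cmod (B ?z)) * (1 - cmod (B ?z))"
          by (simp add: power2_eq_square algebra_simps)
        also have "\<dots> \<le> 2 * (1 - cmod (B ?z))"
          using \<phi>1[OF z1] B\<phi>[OF z1] by (intro mult_right_mono) auto
        also have "1 - cmod (B ?z) \<le> cmod (B ?z - B \<zeta>)"
          using norm_triangle_ineq2[of "B \<zeta>" "B ?z"] B1[OF \<zeta>] by (simp add: norm_minus_commute)
        finally have "\<kappa> * (1 - r) \<le> 2 * cmod (B ?z - B \<zeta>)" by simp
        then show ?case unfolding norm_divide nd using elim by (simp add: field_simps)
      qed
    qed
    ultimately show ?thesis
      by (intro tendsto_lowerbound) auto
  qed
  \<comment> \<open>The first factor bounds the squared quotient from below by \<open>upper\<close>.
    The second is half of Hopf's bound, which leaves room for the continuity of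
    \<open>deriv B\<close> at the boundary point.\<close>
  define c where "c = (1 / (2 * L))\<^sup>2 * (\<kappa> / 4)"
  have "c > 0" using L \<kappa> by (simp add: c_def)
  moreover have "angular_liminf_ge (hyp_distortion \<phi> 2) \<zeta> c" if \<zeta>: "cmod \<zeta> = 1" for \<zeta>
    unfolding angular_liminf_ge_def
  proof (intro allI impI Liminf_bounded)
    fix \<gamma> :: real
    have "isCont (deriv B) \<zeta>"
      using hdB U \<zeta> by (metis continuous_on_interior holomorphic_on_imp_continuous_on interior_open
          mem_cball_0 order_refl subsetD)
    then have "((\<lambda>z. cmod (deriv B z)) \<longlongrightarrow> cmod (deriv B \<zeta>)) (at \<zeta>)"
      by (intro tendsto_norm) (simp add: isCont_def)
    then have "eventually (\<lambda>z. \<kappa> / 4 < cmod (deriv B z)) (at \<zeta>)"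
      using dB_lower[OF \<zeta>] \<kappa> by (intro order_tendstoD) auto
    then have "eventually (\<lambda>z. \<kappa> / 4 < cmod (deriv B z)) (at \<zeta> within angular_region \<gamma> \<zeta>)"
      by (rule filter_leD[OF at_le, rotated]) auto
    moreover have "eventually (\<lambda>z. z \<in> angular_region \<gamma> \<zeta>) (at \<zeta> within angular_region \<gamma> \<zeta>)"
      by (auto simp: eventually_at_filter)
    ultimately show "eventually (\<lambda>z. ereal c \<le> ereal (hyp_distortion \<phi> 2 z)) (at \<zeta> within angular_region \<gamma> \<zeta>)"
    proof eventually_elim
      case (elim z)
      then have z: "cmod z < 1" by (simp add: angular_region_def)
      have "1 / (2 * L) \<le> (1 - (cmod z)\<^sup>2) / (1 - (cmod (\<phi> z))\<^sup>2)"
        using upper[OF z] pos[OF z] L by (simp add: field_simps)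
      then have "c \<le> ((1 - (cmod z)\<^sup>2) / (1 - (cmod (\<phi> z))\<^sup>2))\<^sup>2 * cmod (deriv B z)"
        unfolding c_def using L elim \<kappa> by (intro mult_mono power_mono) auto
      then show ?case using hd[OF z] by simp
    qed
  qed
  ultimately show ?thesis using bdd by (metis norm_cis)
qed

section \<open>Blow-up in cones over a set of positive measure\<close>

text \<open>A weak density theorem. Cover \<open>E\<close> by nonoverlapping intervals of total
  measure at most \<open>(1 + e)\<close> times that of \<open>E\<close>. If \<open>E\<close> filled
  at most the share \<open>1 - e\<close> of each, its measure would shrink by the factor
  \<open>1 - e\<^sup>2\<close>.\<close>

lemma ex_interval_of_almost_full_measure:
  fixes E :: "real set"
  assumes E: "E \<in> lmeasurable" "E \<subseteq> {a..b}" "measure lebesgue E > 0" and e: "0 < e" "e < 1"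
  shows "\<exists>p q. p < q \<and> a \<le> p \<and> q \<le> b \<and> measure lebesgue (E \<inter> {p<..<q}) > (1 - e) * (q - p)"
proof (rule ccontr)
  assume contra: "\<not> ?thesis"
  let ?m = "measure lebesgue"
  obtain D where D: "countable D"
        "\<And>K. K \<in> D \<Longrightarrow> K \<subseteq> cbox a b \<and> K \<noteq> {} \<and> (\<exists>c d. K = cbox c d)"
        "pairwise (\<lambda>A B. interior A \<inter> interior B = {}) D"
        "E \<subseteq> \<Union>D" "\<Union>D \<in> lmeasurable" "?m (\<Union>D) \<le> ?m E + e * ?m E"
    using measurable_outer_intervals_bounded[of E a b "e * ?m E"] E e
    by (metis cbox_interval mult_pos_pos)
  \<comment> \<open>The interiors are disjoint, so measures add up. Only countably many endpoints
    are lost.\<close>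
  define W where "W = (\<Union>K\<in>D. interior K)"
  have cbox: "\<exists>c d. K = {c..d} \<and> c \<le> d \<and> a \<le> c \<and> d \<le> b" if "K \<in> D" for K
    using D(2)[OF that] by (metis atLeastatMost_empty_iff2 atLeastatMost_subset_iff cbox_interval)
  have small: "emeasure lebesgue (E \<inter> interior K) \<le> ennreal (1 - e) * emeasure lebesgue (interior K)"
    if K: "K \<in> D" for K
  proof -
    obtain c d where cd: "K = {c..d}" "c \<le> d" "a \<le> c" "d \<le> b" using cbox[OF K] by blast
    have iK: "interior K = {c<..<d}" using cd by simp
    have "?m (E \<inter> {c<..<d}) \<le> (1 - e) * (d - c)"
    proof (cases "c < d")
      case True
      then show ?thesis using contra cd by (meson not_le)
    next
      case False
      then show ?thesis using cd by simp
    qed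
    moreover have "emeasure lebesgue (E \<inter> {c<..<d}) = ennreal (?m (E \<inter> {c<..<d}))"
      by (intro emeasure_eq_measure2 fmeasurable_Int_fmeasurable E) auto
    ultimately show ?thesis
      using cd e unfolding iK by (simp add: ennreal_mult[symmetric] ennreal_leI)
  qed
  have disj: "disjoint_family_on interior D"
    using D(3) by (auto simp: disjoint_family_on_def pairwise_def)
  then have disjE: "disjoint_family_on (\<lambda>K. E \<inter> interior K) D"
    by (auto simp: disjoint_family_on_def)
  have EW: "emeasure lebesgue (E \<inter> W) \<le> ennreal (1 - e) * emeasure lebesgue W"
  proof -
    have "emeasure lebesgue (E \<inter> W) = emeasure lebesgue (\<Union>K\<in>D. E \<inter> interior K)"
      by (simp add: W_def)
    also have "\<dots> = (\<integral>\<^sup>+K. emeasure lebesgue (E \<inter> interior K) \<partial>count_space D)"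
      using E(1) by (intro emeasure_UN_countable D disjE) (auto simp: fmeasurableD)
    also have "\<dots> \<le> (\<integral>\<^sup>+K. ennreal (1 - e) * emeasure lebesgue (interior K) \<partial>count_space D)"
      using small by (intro nn_integral_mono) auto
    also have "\<dots> = ennreal (1 - e) * (\<integral>\<^sup>+K. emeasure lebesgue (interior K) \<partial>count_space D)"
      by (intro nn_integral_cmult) auto
    also have "(\<integral>\<^sup>+K. emeasure lebesgue (interior K) \<partial>count_space D) = emeasure lebesgue W"
      unfolding W_def by (intro emeasure_UN_countable[symmetric] D disj) auto
    finally show ?thesis .
  qed
  have W: "W \<in> lmeasurable"
  proof (rule fmeasurableI2[OF D(5)])
    show "W \<subseteq> \<Union>D" using interior_subset unfolding W_def by blast
    have "open W" unfolding W_def by auto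
    then show "W \<in> sets lebesgue" by (simp add: sets_completionI_sets borel_open)
  qed
  have "?m W \<le> ?m (\<Union>D)"
    using interior_subset W D(5) unfolding W_def by (intro measure_mono_fmeasurable) blast+
  moreover have "?m (E \<inter> W) \<le> (1 - e) * ?m W"
    using EW e W E
    by (simp add: emeasure_eq_measure2 fmeasurable_Int_fmeasurable fmeasurableD ennreal_mult[symmetric])
  moreover have "?m E = ?m (E \<inter> W)"
  proof (rule measure_negligible_symdiff[OF E(1), symmetric])
    have "negligible (\<Union>K\<in>D. K - interior K)"
    proof (rule negligible_countable_Union)
      fix S assume "S \<in> (\<lambda>K. K - interior K) ` D"
      then obtain K where K: "K \<in> D" "S = K - interior K" by blast
      then obtain c d where "K = {c..d}" using cbox by blast
      then have "S \<subseteq> {c, d}" using K by auto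
      then show "negligible S" using negligible_subset[OF negligible_finite[of "{c, d}"]] by simp
    qed (use D in auto)
    moreover have "(E - E \<inter> W) \<union> (E \<inter> W - E) \<subseteq> (\<Union>K\<in>D. K - interior K)"
      using D(4) unfolding W_def by blast
    ultimately show "negligible (E - E \<inter> W \<union> (E \<inter> W - E))" using negligible_subset by blast
  qed
  ultimately have "?m E \<le> (1 - e) * (?m E + e * ?m E)"
    using D(6) e by (smt (verit) mult_left_mono)
  then have "?m E * e\<^sup>2 \<le> 0" by (simp add: algebra_simps power2_eq_square)
  moreover have "?m E * e\<^sup>2 > 0" using E e by simp
  ultimately show False by simp
qed

text \<open>The comparison function is the real part of \<open>1/4 - u\<^sup>2 + (5/4) \<i> u\<close>, \<open>u = x + \<i> y\<close>, which on the
  rectangle \<open>\<bar>x\<bar> \<le> 1/2\<close>, \<open>0 \<le> y \<le> 1\<close> is nonpositive on the vertical sides and on the top, at most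
  \<open>1/4\<close> on the bottom, and equal to \<open>7/64\<close> at \<open>u = \<i>/8\<close>.\<close>

lemma lower_bound_in_rectangle:
  fixes F :: "complex \<Rightarrow> complex"
  assumes hol: "F holomorphic_on {w. Im w > 0}" and pq: "p < q" and e: "0 < e" "e < 1/8"
    and k: "k > 0" and al: "\<alpha> > 0"
    and lb: "\<And>w. p \<le> Re w \<Longrightarrow> Re w \<le> q \<Longrightarrow> e * (q - p) \<le> Im w \<Longrightarrow> Im w \<le> q - p \<Longrightarrow>
               k * Im w powr (- \<alpha>) \<le> cmod (F w)"
  shows "k * (q - p) powr (- \<alpha>) * e powr (- (7 * \<alpha> / 16)) \<le> cmod (F (Complex ((p + q) / 2) ((q - p) / 8)))"
proof -
  define l where "l = q - p"
  have l: "l > 0" using pq by (simp add: l_def)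
  define m where "m = (p + q) / 2"
  \<comment> \<open>Chosen so that \<open>exp (lam / 4)\<close> equals
    \<open>e powr (- \<alpha>)\<close>, the factor by which the assumed lower bound at height
    \<open>e * l\<close> exceeds the one at height \<open>l\<close>.\<close>
  define lam where "lam = - 4 * \<alpha> * ln e"
  have lam: "lam > 0" using al e by (simp add: lam_def mult_pos_neg)
  define V where "V w = (let u = (w - of_real m) / of_real l in 1/4 - u\<^sup>2 + 5/4 * \<i> * u)" for w :: complex
  have ReV: "Re (V w) = 1/4 - ((Re w - m) / l)\<^sup>2 + (Im w / l)\<^sup>2 - 5/4 * (Im w / l)" for w
    using l by (simp add: V_def Let_def power2_eq_square field_simps)
  define Q where "Q = cbox (Complex p (e * l)) (Complex q l)"
  have Q: "w \<in> Q \<longleftrightarrow> p \<le> Re w \<and> Re w \<le> q \<and> e * l \<le> Im w \<and> Im w \<le> l" for w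
    by (auto simp: Q_def in_cbox_complex_iff)
  have el: "e * l > 0" "e * l < l / 8" using e l by auto
  have Qpos: "Im w > 0" if "w \<in> Q" for w using that el by (auto simp: Q)
  have lbQ: "k * Im w powr (- \<alpha>) \<le> cmod (F w)" if "w \<in> Q" for w
    using lb that by (auto simp: Q l_def)
  have Fnz: "F w \<noteq> 0" if "w \<in> Q" for w
  proof -
    have "k * Im w powr (- \<alpha>) > 0" using k Qpos[OF that] by simp
    then show ?thesis using lbQ[OF that] by auto
  qed
  \<comment> \<open>\<open>F\<close> has no zeros on \<open>Q\<close>, so the maximum principle for
    \<open>g\<close> carries the lower bound for \<open>F\<close> from the sides to
    \<open>w0\<close>.\<close>
  define g where "g w = exp (of_real lam * V w) / F w" for w
  have holg: "g holomorphic_on Q"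
    unfolding g_def V_def Let_def using Qpos Fnz l
    by (intro holomorphic_intros holomorphic_on_subset[OF hol]) auto
  define w0 where "w0 = Complex m (l / 8)"
  have ng: "cmod (g w) = exp (lam * Re (V w)) / cmod (F w)" for w
    by (simp add: g_def norm_divide)
  have "cmod (g w0) \<le> l powr \<alpha> / k"
  proof (rule maximum_modulus_frontier[of g Q])
    show "g holomorphic_on interior Q" "continuous_on (closure Q) g"
      using holg interior_subset[of Q]
      by (auto simp: Q_def intro: holomorphic_on_subset holomorphic_on_imp_continuous_on)
    show "bounded Q" by (simp add: Q_def)
    show "w0 \<in> Q" using pq el e l by (auto simp: Q w0_def m_def)
    fix w assume "w \<in> frontier Q"
    then have wQ: "w \<in> Q" and bd: "Re w = p \<or> Re w = q \<or> Im w = e * l \<or> Im w = l"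
      unfolding Q_def frontier_cbox by (auto simp: in_cbox_complex_iff in_box_complex_iff)
    have y: "Im w / l > 0" "Im w / l \<le> 1" using wQ l el by (auto simp: Q divide_simps)
    have Fge: "k * Im w powr (- \<alpha>) \<le> cmod (F w)" using lbQ[OF wQ] .
    have ypow: "l powr (- \<alpha>) \<le> Im w powr (- \<alpha>)"
      using wQ Qpos[OF wQ] al by (intro powr_mono2') (auto simp: Q)
    have yy: "(Im w / l)\<^sup>2 \<le> Im w / l"
      using power_decreasing[of 1 2 "Im w / l"] y by simp
    show "cmod (g w) \<le> l powr \<alpha> / k"
    \<comment> \<open>On the bottom the exponential may reach \<open>e powr (- \<alpha>)\<close>,
      and the stronger bound for \<open>F\<close> there absorbs it. On the other sides the
      exponential is at most 1.\<close>
    proof (cases "Im w = e * l")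
      case True
      have "Re (V w) \<le> 1/4" unfolding ReV using yy y zero_le_power2[of "(Re w - m) / l"] by linarith
      then have "lam * Re (V w) \<le> - \<alpha> * ln e"
        using mult_left_mono[of "Re (V w)" "1/4" lam] lam by (simp add: lam_def)
      then have "exp (lam * Re (V w)) \<le> e powr (- \<alpha>)"
        using e by (simp add: powr_def)
      moreover have "k * (e powr (- \<alpha>) * l powr (- \<alpha>)) \<le> cmod (F w)"
        using Fge True e l by (simp add: powr_mult)
      ultimately have "exp (lam * Re (V w)) / cmod (F w) \<le> e powr (- \<alpha>) / (k * (e powr (- \<alpha>) * l powr (- \<alpha>)))"
        using k e l by (intro frac_le) auto
      also have "\<dots> = l powr \<alpha> / k"
        using e l k by (simp add: powr_minus field_simps)
      finally show ?thesis unfolding ng .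
    next
      case False
      have "Re (V w) \<le> 0"
      proof (cases "Im w = l")
        case True
        then show ?thesis unfolding ReV using l by simp
      next
        case False
        then have "(Re w - m) / l = 1/2 \<or> (Re w - m) / l = - 1/2"
          using bd \<open>Im w \<noteq> e * l\<close> pq unfolding m_def l_def by (auto simp: field_simps)
        then have "((Re w - m) / l)\<^sup>2 = 1/4"
        proof
          assume x: "(Re w - m) / l = 1/2"
          show ?thesis unfolding x by (simp add: power2_eq_square)
        next
          assume x: "(Re w - m) / l = - 1/2"
          show ?thesis unfolding x by (simp add: power2_eq_square)
        qed
        then show ?thesis unfolding ReV using yy y by linarith
      qed
      then have "exp (lam * Re (V w)) \<le> 1" using lam by (simp add: mult_nonneg_nonpos)
      moreover have "k * l powr (- \<alpha>) \<le> cmod (F w)"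
        using Fge ypow k by (smt (verit) mult_left_mono)
      ultimately have "exp (lam * Re (V w)) / cmod (F w) \<le> 1 / (k * l powr (- \<alpha>))"
        using k l by (intro frac_le) auto
      also have "\<dots> = l powr \<alpha> / k"
        using l k by (simp add: powr_minus field_simps)
      finally show ?thesis unfolding ng .
    qed
  qed
  moreover have "Re (V w0) = 7/64"
    unfolding ReV using l by (simp add: w0_def power2_eq_square)
  then have "exp (lam * Re (V w0)) = e powr (- (7 * \<alpha> / 16))"
    using e by (simp add: powr_def lam_def)
  moreover have "w0 \<in> Q" using pq el e l by (auto simp: Q w0_def m_def)
  then have "cmod (F w0) > 0" using Fnz by simp
  ultimately have "e powr (- (7 * \<alpha> / 16)) * k \<le> l powr \<alpha> * cmod (F w0)"
    using k by (simp add: ng field_simps)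
  then have "e powr (- (7 * \<alpha> / 16)) * k * l powr (- \<alpha>) \<le> l powr \<alpha> * cmod (F w0) * l powr (- \<alpha>)"
    by (intro mult_right_mono) auto
  also have "\<dots> = cmod (F w0)"
    using l by (simp add: powr_minus field_simps)
  finally show ?thesis unfolding w0_def m_def l_def by (simp add: mult_ac)
qed

text \<open>Used to confine a set of positive measure to an interval of prescribed length.\<close>

lemma negligible_if_negligible_on_short_intervals:
  fixes E :: "real set"
  assumes d: "d > 0" and E: "\<And>x. negligible (E \<inter> {x..x+d})"
  shows "negligible E"
proof -
  have "negligible (\<Union>k::int. E \<inter> {of_int k * d..of_int k * d + d})"
    using E by (intro negligible_countable_Union) auto
  moreover have "E \<subseteq> (\<Union>k::int. E \<inter> {of_int k * d..of_int k * d + d})"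
  proof
    fix t assume "t \<in> E"
    moreover have "of_int \<lfloor>t / d\<rfloor> * d \<le> t" "t \<le> of_int \<lfloor>t / d\<rfloor> * d + d"
      using floor_divide_lower[OF d, of t] floor_divide_upper[OF d, of t] by (auto simp: algebra_simps)
    ultimately show "t \<in> (\<Union>k::int. E \<inter> {of_int k * d..of_int k * d + d})" by auto
  qed
  ultimately show ?thesis using negligible_subset by blast
qed

text \<open>Some set \<open>E n\<close> of points with cones of a common height has positive measure
  and nearly fills an interval of length \<open>l\<close>. Cones over it cover the rectangle between
  the heights \<open>e * l\<close> and \<open>l\<close>, and the resulting gain
  \<open>e powr (- (7 * \<alpha> / 16))\<close> at height \<open>l / 8\<close> exceeds the upper
  bound.\<close>

lemma no_blowup_in_almost_all_cones:
  fixes F :: "complex \<Rightarrow> complex"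
  assumes hol: "F holomorphic_on {w. Im w > 0}" and k: "k > 0" and al: "\<alpha> > 0" and h: "h > 0"
    and ub: "\<And>w. 0 < Im w \<Longrightarrow> Im w < h \<Longrightarrow> cmod (F w) \<le> M * Im w powr (- \<alpha>)"
    and N: "negligible N" and ab: "a < b"
    and lb: "\<And>t. a < t \<Longrightarrow> t < b \<Longrightarrow> t \<notin> N \<Longrightarrow>
       \<exists>\<delta>>0. \<forall>w. 0 < Im w \<and> Im w < \<delta> \<and> \<bar>Re w - t\<bar> \<le> Im w \<longrightarrow> k * Im w powr (- \<alpha>) \<le> cmod (F w)"
  shows False
proof -
  \<comment> \<open>The cones are open here, so each point \<open>w\<close> violating the bound
    excludes an open set of \<open>t\<close>, and \<open>E n\<close> is closed, hence
    measurable.\<close>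
  define E where "E n = {t \<in> {a..b}. \<forall>w. 0 < Im w \<and> Im w < 1 / real (Suc n) \<and> \<bar>Re w - t\<bar> < Im w \<longrightarrow>
     k * Im w powr (- \<alpha>) \<le> cmod (F w)}" for n
  have closedE: "closed (E n)" for n
  proof -
    have "E n = {a..b} \<inter> (\<Inter>w\<in>{w. 0 < Im w \<and> Im w < 1 / real (Suc n) \<and> \<not> k * Im w powr (- \<alpha>) \<le> cmod (F w)}.
       {t. Im w \<le> \<bar>Re w - t\<bar>})"
      unfolding E_def by (auto simp: not_less) (meson not_le)+
    moreover have "closed {t. Im w \<le> \<bar>Re w - t\<bar>}" for w
      by (intro closed_Collect_le continuous_intros)
    ultimately show ?thesis by (metis (no_types, lifting) closed_Int closed_INT closed_atLeastAtMost)
  qed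
  have "{a<..<b} \<subseteq> N \<union> (\<Union>n. E n)"
  proof
    fix t assume t: "t \<in> {a<..<b}"
    show "t \<in> N \<union> (\<Union>n. E n)"
    proof (cases "t \<in> N")
      case False
      then obtain d where d: "d > 0" "\<forall>w. 0 < Im w \<and> Im w < d \<and> \<bar>Re w - t\<bar> \<le> Im w \<longrightarrow> k * Im w powr (- \<alpha>) \<le> cmod (F w)"
        using lb[of t] t by auto
      obtain n where "1 / real (Suc n) < d"
        using reals_Archimedean[OF d(1)] by (auto simp: inverse_eq_divide)
      then have "t \<in> E n" unfolding E_def using t d(2) by auto
      then show ?thesis by blast
    qed auto
  qed
  moreover have "\<not> negligible {a<..<b}"
    using ab open_not_negligible[of "{a<..<b}"] by auto
  ultimately have "\<not> negligible (\<Union>n. E n)"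
    using N negligible_Un negligible_subset by blast
  then obtain n where n: "\<not> negligible (E n)"
    using negligible_Union_nat[of E] by blast
  \<comment> \<open>Both bounds at the centre scale like \<open>l powr (- \<alpha>)\<close>, so
    \<open>e\<close> can be fixed before the interval. The factor \<open>8 powr \<alpha>\<close>
    comes from evaluating at height \<open>l / 8\<close>.\<close>
  obtain e where e: "0 < e" "e < 1/8" "e powr (7 * \<alpha> / 16) * (M * 8 powr \<alpha>) < k"
  proof -
    have "((\<lambda>e. e powr (7 * \<alpha> / 16) * (M * 8 powr \<alpha>)) \<longlongrightarrow> 0 powr (7 * \<alpha> / 16) * (M * 8 powr \<alpha>)) (at_right 0)"
      using al by (intro tendsto_intros tendsto_powr') (auto simp: eventually_at_right_less intro: eventually_mono[OF eventually_at_right_less])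
    then have "eventually (\<lambda>e. e powr (7 * \<alpha> / 16) * (M * 8 powr \<alpha>) < k) (at_right 0)"
      using k by (intro order_tendstoD) auto
    moreover have "eventually (\<lambda>e::real. 0 < e \<and> e < 1/8) (at_right 0)"
      by (auto simp: eventually_at_right_field intro: exI[of _ "1/8"])
    ultimately have "eventually (\<lambda>e. 0 < e \<and> e < 1/8 \<and> e powr (7 * \<alpha> / 16) * (M * 8 powr \<alpha>) < k) (at_right 0)"
      by eventually_elim auto
    then show ?thesis using that eventually_happens'[OF trivial_limit_at_right_real] by blast
  qed
  \<comment> \<open>Rectangles over intervals no longer than \<open>d\<close> stay below
    \<open>h\<close> and below the common cone height.\<close>
  define d where "d = min h (1 / real (Suc n)) / 2"
  have d: "d > 0" "d < h" "d < 1 / real (Suc n)"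
    using h by (auto simp: d_def min_def field_simps)
  obtain x where x: "\<not> negligible (E n \<inter> {x..x+d})"
    using negligible_if_negligible_on_short_intervals[OF d(1)] n by blast
  define G where "G = E n \<inter> {x..x+d}"
  have "compact G" unfolding G_def using closedE by (intro closed_Int_compact) auto
  then have G: "G \<in> lmeasurable" by (rule lmeasurable_compact)
  have "measure lebesgue G > 0"
    using x G unfolding G_def[symmetric]
    by (metis fmeasurableD2 measure_nonneg negligible_iff_measure order_le_less)
  then obtain p q where pq: "p < q" "x \<le> p" "q \<le> x + d"
      "measure lebesgue (G \<inter> {p<..<q}) > (1 - e) * (q - p)"
    using ex_interval_of_almost_full_measure[OF G, of x "x + d" e] e G_def by auto
  define l where "l = q - p"
  have l: "0 < l" "l \<le> d" using pq by (auto simp: l_def)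
  \<comment> \<open>Otherwise \<open>G\<close> misses a gap of length \<open>e * l\<close> with left
    end \<open>c\<close>, inside \<open>{p..q}\<close> and with \<open>r\<close> in its closure.
    That costs too much measure.\<close>
  have hit: "\<exists>t\<in>G. \<bar>r - t\<bar> < e * l" if r: "p \<le> r" "r \<le> q" for r
  proof (rule ccontr)
    assume no: "\<not> ?thesis"
    have el: "e * l < l" "e * l > 0" using e l by auto
    obtain c where c: "p \<le> c" "c + e * l \<le> q" "c \<le> r" "r \<le> c + e * l"
    proof (cases "r + e * l \<le> q")
      case True
      then show ?thesis using that[of r] r el by auto
    next
      case False
      then show ?thesis using that[of "q - e * l"] r el by (auto simp: l_def)
    qed
    have "G \<inter> {p<..<q} \<subseteq> {p..q} - {c<..<c + e * l}"
    proof
      fix t assume t: "t \<in> G \<inter> {p<..<q}"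
      then have "e * l \<le> \<bar>r - t\<bar>" using no by force
      then show "t \<in> {p..q} - {c<..<c + e * l}" using t c by auto
    qed
    then have "measure lebesgue (G \<inter> {p<..<q}) \<le> measure lebesgue ({p..q} - {c<..<c + e * l})"
      using G by (intro measure_mono_fmeasurable) (auto simp: fmeasurableD intro!: fmeasurable_Diff)
    also have "\<dots> = measure lebesgue {p..q} - measure lebesgue {c<..<c + e * l}"
      using c by (intro measurable_measure_Diff) auto
    also have "\<dots> = (q - p) - e * l" using pq el by simp
    finally show False using pq(4) by (simp add: l_def algebra_simps)
  qed
  have "k * (q - p) powr (- \<alpha>) * e powr (- (7 * \<alpha> / 16)) \<le> cmod (F (Complex ((p + q) / 2) ((q - p) / 8)))"
  proof (rule lower_bound_in_rectangle[OF hol pq(1) e(1,2) k al])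
    fix w assume w: "p \<le> Re w" "Re w \<le> q" "e * (q - p) \<le> Im w" "Im w \<le> q - p"
    obtain t where t: "t \<in> G" "\<bar>Re w - t\<bar> < e * l" using hit w by blast
    have "0 < e * l" using e l by simp
    then have "0 < Im w \<and> Im w < 1 / real (Suc n) \<and> \<bar>Re w - t\<bar> < Im w"
      using t w l d unfolding l_def by linarith
    then show "k * Im w powr (- \<alpha>) \<le> cmod (F w)" using t(1) unfolding G_def E_def by blast
  qed
  also have "\<dots> \<le> M * (l / 8) powr (- \<alpha>)"
    using ub[of "Complex ((p + q) / 2) ((q - p) / 8)"] l d unfolding l_def by simp
  also have "\<dots> = M * 8 powr \<alpha> * l powr (- \<alpha>)"
    using l by (simp add: powr_divide powr_minus field_simps)
  finally have "k * e powr (- (7 * \<alpha> / 16)) * l powr (- \<alpha>) \<le> M * 8 powr \<alpha> * l powr (- \<alpha>)"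
    by (simp add: l_def mult_ac)
  then have "k * e powr (- (7 * \<alpha> / 16)) \<le> M * 8 powr \<alpha>"
    using l by simp
  then have "k * e powr (- (7 * \<alpha> / 16)) * e powr (7 * \<alpha> / 16) \<le> M * 8 powr \<alpha> * e powr (7 * \<alpha> / 16)"
    by (intro mult_right_mono) auto
  moreover have "e powr (- (7 * \<alpha> / 16)) * e powr (7 * \<alpha> / 16) = 1"
    using e by (simp flip: powr_add)
  ultimately have "k \<le> M * 8 powr \<alpha> * e powr (7 * \<alpha> / 16)"
    by (simp only: mult.assoc mult_1_right)
  then show False using e(3) by (simp add: mult_ac)
qed

section \<open>Lower bounds on the distortion\<close>

lemma angular_liminf_geD:
  assumes "angular_liminf_ge f \<zeta> c" "\<gamma> > 1" "b < c"
  obtains d where "d > 0"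
    "\<And>z. z \<in> angular_region \<gamma> \<zeta> \<Longrightarrow> z \<noteq> \<zeta> \<Longrightarrow> dist z \<zeta> < d \<Longrightarrow> b < f z"
proof -
  have "ereal c \<le> Liminf (at \<zeta> within angular_region \<gamma> \<zeta>) (\<lambda>z. ereal (f z))"
    using assms by (auto simp: angular_liminf_ge_def)
  then have "eventually (\<lambda>z. ereal b < ereal (f z)) (at \<zeta> within angular_region \<gamma> \<zeta>)"
    using assms(3) unfolding le_Liminf_iff by (metis ereal_less_eq(3) linorder_not_less)
  then show ?thesis using that unfolding eventually_at by auto
qed

lemma AE_lebesgue_on_negligible:
  fixes S :: "real set"
  assumes "AE t in lebesgue_on S. P t" "S \<in> sets lebesgue"
  obtains N where "negligible N" "\<And>t. t \<in> S \<Longrightarrow> t \<notin> N \<Longrightarrow> P t"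
proof -
  have "AE t in lebesgue. t \<in> S \<longrightarrow> P t"
    using assms by (subst (asm) AE_restrict_space_iff) auto
  then obtain N where "N \<in> null_sets lebesgue" "{t. \<not> (t \<in> S \<longrightarrow> P t)} \<subseteq> N"
    by (auto simp: eventually_ae_filter)
  then show ?thesis using that[of N] by (auto simp: negligible_iff_null_sets)
qed

text \<open>Move first radially to the circle, then along the arc, whose chord is at most its
  angle.\<close>

lemma dist_polar_le:
  assumes "0 \<le> r" "r \<le> 1"
  shows "cmod (of_real r * cis s - cis t) \<le> (1 - r) + \<bar>s - t\<bar>"
proof -
  have "of_real r * cis s - cis t = of_real (r - 1) * cis s + (cis s - cis t)"
    by (simp add: algebra_simps)
  also have "cmod \<dots> \<le> cmod (of_real (r - 1) * cis s) + cmod (cis s - cis t)"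
    by (rule norm_triangle_ineq)
  also have "cmod (of_real (r - 1) * cis s) = 1 - r"
    using assms by (simp add: norm_mult del: of_real_diff)
  also have "cmod (cis s - cis t) \<le> \<bar>s - t\<bar>"
  proof -
    have "cis s - cis t = cis t * (exp (\<i> * of_real (s - t)) - 1)"
      by (simp add: cis_conv_exp exp_diff algebra_simps)
    then have "cmod (cis s - cis t) = 2 * \<bar>sin ((s - t) / 2)\<bar>"
      by (simp only: norm_mult norm_cis dist_exp_i_1 mult_1_left)
    also have "\<dots> \<le> \<bar>s - t\<bar>"
      using abs_sin_x_le_abs_x[of "(s - t) / 2"] by simp
    finally show ?thesis .
  qed
  finally show ?thesis by simp
qed

lemma exists_regular_parameter:
  assumes N: "negligible N" and e: "e > 0" and s: "0 \<le> s" "s < 2 * pi"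
  obtains t where "t \<in> {0..2*pi}" "t \<notin> N" "\<bar>t - s\<bar> < e"
proof -
  let ?I = "{s<..<min (2*pi) (s + e)}"
  have "\<not> negligible ?I"
    using e s by (intro open_not_negligible) auto
  then obtain t where "t \<in> ?I" "t \<notin> N"
    using N negligible_subset by blast
  then show ?thesis using that[of t] s by auto
qed

section \<open>Exponents above 1: Julia's lemma along a dense set of radii\<close>

lemma tendsto_norm_if_distortion_ge_exponent_gt_1:
  assumes hol: "\<phi> holomorphic_on ball 0 1" and maps: "\<phi> ` ball 0 1 \<subseteq> ball 0 1"
    and al: "\<alpha> > 1" and c: "c > 0"
    and AE: "AE t in lebesgue_on {0..2*pi}. angular_liminf_ge (hyp_distortion \<phi> \<alpha>) (cis t) c"
  shows "((\<lambda>z. cmod (\<phi> z)) \<longlongrightarrow> 1) at_unit_circle"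
proof -
  obtain N where N: "negligible N"
    "\<And>t. t \<in> {0..2*pi} \<Longrightarrow> t \<notin> N \<Longrightarrow> angular_liminf_ge (hyp_distortion \<phi> \<alpha>) (cis t) c"
    using AE_lebesgue_on_negligible[OF AE] by auto
  have \<phi>1: "cmod (\<phi> z) < 1" if "cmod z < 1" for z
    using maps that by (auto simp: image_subset_iff)
  have pos: "1 - (cmod z)\<^sup>2 > 0" "1 - (cmod (\<phi> z))\<^sup>2 > 0" if "cmod z < 1" for z
    using that \<phi>1[OF that] by (auto simp: abs_square_less_1)
  \<comment> \<open>With \<open>D / A\<close> the quotient in \<open>ratio\<close>, Schwarz-Pick
    bounds the distortion by \<open>(D / A) powr (1 - \<alpha>)\<close>. Comparing with
    \<open>c / 2\<close> and solving for \<open>D / A\<close> gives \<open>C\<close>, because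
    \<open>\<alpha> - 1\<close> is positive.\<close>
  define C where "C = (2 / c) powr (1 / (\<alpha> - 1))"
  have C: "C > 0" using c by (simp add: C_def)
  have ratio: "1 - (cmod (\<phi> w))\<^sup>2 \<le> C * (1 - (cmod w)\<^sup>2)"
    if w: "cmod w < 1" and d: "c / 2 < hyp_distortion \<phi> \<alpha> w" for w
  proof -
    define A where "A = 1 - (cmod w)\<^sup>2"
    define D where "D = 1 - (cmod (\<phi> w))\<^sup>2"
    have AD: "A > 0" "D > 0" using pos[OF w] by (auto simp: A_def D_def)
    have "cmod (deriv \<phi> w) \<le> D / A"
      using Schwarz_Pick_deriv[OF hol maps w] AD by (simp add: A_def D_def field_simps)
    then have "hyp_distortion \<phi> \<alpha> w \<le> A powr \<alpha> * (D / A) / D powr \<alpha>"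
      unfolding hyp_distortion_def A_def[symmetric] D_def[symmetric]
      by (intro divide_right_mono mult_left_mono) auto
    also have "\<dots> = 1 / (D / A) powr (\<alpha> - 1)"
      using AD by (simp add: powr_divide powr_diff field_simps)
    finally have "c / 2 \<le> 1 / (D / A) powr (\<alpha> - 1)" using d by simp
    then have "(D / A) powr (\<alpha> - 1) \<le> 2 / c"
      using AD c by (simp add: field_simps)
    then have "((D / A) powr (\<alpha> - 1)) powr (1 / (\<alpha> - 1)) \<le> C"
      unfolding C_def using al by (intro powr_mono2) auto
    then have "D / A \<le> C" using al AD by (simp add: powr_powr)
    then show ?thesis using AD by (simp add: A_def D_def field_simps)
  qed
  have approx: "\<exists>w. cmod w < 1 \<and> cmod (w - cis s) < e \<and> 1 - (cmod (\<phi> w))\<^sup>2 \<le> C * (1 - (cmod w)\<^sup>2)"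
    if e: "e > 0" and s: "0 \<le> s" "s < 2 * pi" for e s
  proof -
    obtain t where t: "t \<in> {0..2*pi}" "t \<notin> N" "\<bar>t - s\<bar> < e / 2"
      using exists_regular_parameter[OF N(1) _ s] e half_gt_zero by metis
    obtain d where d: "d > 0"
      "\<And>z. z \<in> angular_region 2 (cis t) \<Longrightarrow> z \<noteq> cis t \<Longrightarrow> dist z (cis t) < d \<Longrightarrow> c / 2 < hyp_distortion \<phi> \<alpha> z"
      using angular_liminf_geD[OF N(2)[OF t(1,2)], of 2 "c/2"] c by auto
    \<comment> \<open>Close enough to 1 for both distance conditions, while the cap at 1 keeps
      \<open>r\<close> at least \<open>1/2\<close>.\<close>
    define r where "r = 1 - min (min d e) 1 / 2"
    have r: "0 < r" "r < 1" "1 - r < d" "1 - r \<le> e / 2"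
      using d(1) e by (auto simp: r_def min_def)
    define w where "w = of_real r * cis t"
    have nw: "cmod w = r" using r by (simp add: w_def norm_mult)
    have dw: "cmod (w - cis t) \<le> 1 - r"
      using dist_polar_le[of r t t] r by (simp add: w_def)
    have "1 - r \<le> 2 * (1 - r\<^sup>2)"
      using r power_decreasing[of 1 2 r] by simp
    then have "w \<in> angular_region 2 (cis t)"
      using dw nw r by (simp add: angular_region_def norm_minus_commute)
    moreover have "w \<noteq> cis t" using nw r by auto
    ultimately have "c / 2 < hyp_distortion \<phi> \<alpha> w"
      using d(2) dw r by (simp add: dist_norm)
    moreover have "cmod (w - cis s) < e"
      using dist_polar_le[of r t s] r t by (simp add: w_def)
    ultimately show ?thesis using ratio nw r by blast
  qed
  have key: "1 - cmod (\<phi> z) \<le> 2 * C * (1 - cmod z)" if z: "cmod z < 1" for z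
  proof -
    define s where "s = Arg2pi z"
    have s: "0 \<le> s" "s < 2 * pi" using Arg2pi[of z] by (auto simp: s_def)
    have zs: "z = of_real (cmod z) * cis s"
      using Arg2pi[of z] by (simp add: s_def is_Arg_def cis_conv_exp)
    \<comment> \<open>Schwarz-Pick for \<open>z\<close> and a good point \<open>w\<close> within
      \<open>e\<close> of the radial projection of \<open>z\<close>. The factor
      \<open>1 - (cmod w)\<^sup>2\<close> cancels, so \<open>e\<close> can then tend to 0.\<close>
    have "(1 - cmod (\<phi> z)) * (1 - (cmod z)\<^sup>2) \<le> 2 * C * (1 - cmod z + e)\<^sup>2" if e: "e > 0" for e
    proof -
      obtain w where w: "cmod w < 1" "cmod (w - cis s) < e" "1 - (cmod (\<phi> w))\<^sup>2 \<le> C * (1 - (cmod w)\<^sup>2)"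
        using approx[OF e s] by blast
      have "cnj (cis s) * z = of_real (cmod z)"
        by (subst zs) (simp add: cis_cnj cis_mult)
      then have "1 - cnj w * z = of_real (1 - cmod z) - cnj (w - cis s) * z"
        by (simp add: algebra_simps)
      then have "cmod (1 - cnj w * z) \<le> cmod (of_real (1 - cmod z)) + cmod (cnj (w - cis s) * z)"
        by (metis norm_triangle_ineq4)
      also have "\<dots> \<le> (1 - cmod z) + e"
      proof -
        have "cmod (cnj (w - cis s) * z) \<le> e * 1"
          unfolding norm_mult complex_mod_cnj using w z e by (intro mult_mono) auto
        then show ?thesis using z by (simp del: of_real_diff)
      qed
      finally have n1: "(cmod (1 - cnj w * z))\<^sup>2 \<le> (1 - cmod z + e)\<^sup>2"
        by (intro power_mono) auto
      have "cmod (cnj (\<phi> w) * \<phi> z) \<le> cmod (\<phi> z)"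
        unfolding norm_mult complex_mod_cnj
        using \<phi>1[OF w(1)] by (simp add: mult_left_le_one_le)
      then have "1 - cmod (\<phi> z) \<le> cmod (1 - cnj (\<phi> w) * \<phi> z)"
        using norm_triangle_ineq2[of 1 "cnj (\<phi> w) * \<phi> z"] by simp
      then have n2: "(1 - cmod (\<phi> z))\<^sup>2 \<le> (cmod (1 - cnj (\<phi> w) * \<phi> z))\<^sup>2"
        using \<phi>1[OF z] by (intro power_mono) auto
      have p: "0 < (1 - cmod (\<phi> z))\<^sup>2" using \<phi>1[OF z] by simp
      have nz: "0 < (cmod (1 - cnj w * z))\<^sup>2"
        using one_minus_cnj_mult_nonzero[of w z] w z by simp
      have "(1 - (cmod w)\<^sup>2) * ((1 - (cmod z)\<^sup>2) / (cmod (1 - cnj w * z))\<^sup>2) \<le>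
         (1 - (cmod (\<phi> w))\<^sup>2) * (1 - (cmod (\<phi> z))\<^sup>2) / (cmod (1 - cnj (\<phi> w) * \<phi> z))\<^sup>2"
        using Schwarz_Pick[OF hol maps w(1) z] by simp
      also have "\<dots> \<le> (C * (1 - (cmod w)\<^sup>2)) * (1 - (cmod (\<phi> z))\<^sup>2) / (1 - cmod (\<phi> z))\<^sup>2"
        using w(3) n2 p pos[OF z] pos[OF w(1)] C by (intro frac_le mult_right_mono) auto
      also have "\<dots> = (1 - (cmod w)\<^sup>2) * (C * (1 + cmod (\<phi> z)) / (1 - cmod (\<phi> z)))"
        using \<phi>1[OF z] by (simp add: power2_eq_square divide_simps) (simp add: algebra_simps)
      finally have "(1 - (cmod z)\<^sup>2) / (cmod (1 - cnj w * z))\<^sup>2 \<le> C * (1 + cmod (\<phi> z)) / (1 - cmod (\<phi> z))"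
        using pos(1)[OF w(1)] by (meson mult_le_cancel_left_pos)
      also have "\<dots> \<le> C * 2 / (1 - cmod (\<phi> z))"
        using \<phi>1[OF z] C by (intro divide_right_mono mult_left_mono) auto
      finally have "(1 - cmod (\<phi> z)) * (1 - (cmod z)\<^sup>2) \<le> 2 * C * (cmod (1 - cnj w * z))\<^sup>2"
        using nz \<phi>1[OF z] by (simp add: divide_simps mult_ac)
      also have "\<dots> \<le> 2 * C * (1 - cmod z + e)\<^sup>2"
        using n1 C by (intro mult_left_mono) auto
      finally show ?thesis .
    qed
    then have "eventually (\<lambda>e. (1 - cmod (\<phi> z)) * (1 - (cmod z)\<^sup>2) \<le> 2 * C * (1 - cmod z + e)\<^sup>2) (at_right 0)"
      by (auto intro: eventually_mono[OF eventually_at_right_less])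
    moreover have "((\<lambda>e. 2 * C * (1 - cmod z + e)\<^sup>2) \<longlongrightarrow> 2 * C * (1 - cmod z + 0)\<^sup>2) (at_right 0)"
      by (intro tendsto_intros)
    ultimately have "(1 - cmod (\<phi> z)) * (1 - (cmod z)\<^sup>2) \<le> 2 * C * (1 - cmod z)\<^sup>2"
      using tendsto_lowerbound by fastforce
    then have "(1 - cmod (\<phi> z)) * (1 + cmod z) * (1 - cmod z) \<le> 2 * C * (1 - cmod z) * (1 - cmod z)"
      by (simp add: power2_eq_square algebra_simps)
    then have "(1 - cmod (\<phi> z)) * (1 + cmod z) \<le> 2 * C * (1 - cmod z)"
      using z by (simp del: mult_le_cancel_right_pos add: mult_le_cancel_right)
    moreover have "(1 - cmod (\<phi> z)) * 1 \<le> (1 - cmod (\<phi> z)) * (1 + cmod z)"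
      using \<phi>1[OF z] by (intro mult_left_mono) auto
    ultimately show ?thesis by (metis mult.right_neutral order_trans)
  qed
  have ev: "eventually (\<lambda>z. cmod z < 1) at_unit_circle"
    by (auto simp: eventually_at_unit_circle intro: exI[of _ 0])
  show ?thesis
  proof (rule tendsto_sandwich)
    show "eventually (\<lambda>z. 1 - 2 * C * (1 - cmod z) \<le> cmod (\<phi> z)) at_unit_circle"
      using ev by eventually_elim (use key in force)
    show "eventually (\<lambda>z. cmod (\<phi> z) \<le> 1) at_unit_circle"
      using ev by eventually_elim (use \<phi>1 in force)
    have "((\<lambda>z. 1 - 2 * C * (1 - cmod z)) \<longlongrightarrow> 1 - 2 * C * (1 - 1)) at_unit_circle"
      by (intro tendsto_diff tendsto_mult tendsto_const tendsto_norm_at_unit_circle)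
    then show "((\<lambda>z. 1 - 2 * C * (1 - cmod z)) \<longlongrightarrow> 1) at_unit_circle" by simp
  qed auto
qed

section \<open>Exponents below 1: continuity up to the circle and blow-up of the derivative\<close>

text \<open>For \<open>\<alpha> < 1\<close> the derivative bound is integrable along radii, so the
  functions \<open>f (s * z)\<close>, uniformly continuous for \<open>s < 1\<close>, approximate
  \<open>f\<close> uniformly.\<close>

lemma uniformly_continuous_on_disc_if_deriv_bound:
  assumes hol: "f holomorphic_on ball 0 1" and al: "0 < \<alpha>" "\<alpha> < 1" and M: "M \<ge> 0"
    and bnd: "\<And>z. cmod z < 1 \<Longrightarrow> cmod (deriv f z) \<le> M * (1 - cmod z) powr (- \<alpha>)"
  shows "uniformly_continuous_on (ball 0 1) f"
proof -
  \<comment> \<open>The integral of \<open>M * (1 - t) powr (- \<alpha>)\<close> over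
    \<open>t\<close> from \<open>s\<close> to 1.\<close>
  define \<omega> where "\<omega> s = M * (1 - s) powr (1 - \<alpha>) / (1 - \<alpha>)" for s
  have radial: "cmod (f z - f (of_real s * z)) \<le> \<omega> s" if z: "cmod z < 1" and s: "0 \<le> s" "s < 1" for z s
  proof -
    have tz: "cmod (of_real t * z) < 1" if "0 \<le> t" "t \<le> 1" for t
    proof -
      have "t * cmod z \<le> cmod z" using that by (simp add: mult_left_le_one_le)
      then show ?thesis using that z by (simp add: norm_mult)
    qed
    have "norm (f (of_real 1 * z) - f (of_real s * z)) \<le> (- \<omega> 1) - (- \<omega> s)"
    proof (rule differentiable_bound_general[OF s(2), where f = "\<lambda>t. f (of_real t * z)" and \<phi> = "\<lambda>t. - \<omega> t"
          and f' = "\<lambda>t. z * deriv f (of_real t * z)" and \<phi>' = "\<lambda>t. M * (1 - t) powr (- \<alpha>)"])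
      show "continuous_on {s..1} (\<lambda>t. f (of_real t * z))"
        by (rule continuous_on_compose2[OF holomorphic_on_imp_continuous_on[OF hol]])
           (use tz s in \<open>auto intro!: continuous_intros\<close>)
      show "continuous_on {s..1} (\<lambda>t. - \<omega> t)"
        unfolding \<omega>_def using al by (intro continuous_intros continuous_on_powr') auto
      fix t assume t: "s < t" "t < 1"
      have "(f has_field_derivative deriv f (of_real t * z)) (at (of_real t * z))"
        using hol tz[of t] t s by (intro holomorphic_derivI[of _ "ball 0 1"]) auto
      moreover have "((\<lambda>t. of_real t * z) has_vector_derivative z) (at t)"
        by (auto intro!: derivative_eq_intros)
      ultimately show "((\<lambda>t. f (of_real t * z)) has_vector_derivative z * deriv f (of_real t * z)) (at t)"
        using field_vector_diff_chain_at[of "\<lambda>t. of_real t * z" z t f] by (simp add: o_def)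
      have "((\<lambda>t. - \<omega> t) has_real_derivative M * (1 - t) powr (- \<alpha>)) (at t)"
      proof -
        have "((\<lambda>t. (1 - t) powr (1 - \<alpha>)) has_real_derivative - ((1 - \<alpha>) * (1 - t) powr (- \<alpha>))) (at t)"
          using t by (auto intro!: derivative_eq_intros)
        from DERIV_cmult[OF this, of "- (M / (1 - \<alpha>))"] show ?thesis
          unfolding \<omega>_def using al by simp
      qed
      then show "((\<lambda>t. - \<omega> t) has_vector_derivative M * (1 - t) powr (- \<alpha>)) (at t)"
        by (simp add: has_real_derivative_iff_has_vector_derivative)
      have "cmod (z * deriv f (of_real t * z)) \<le> 1 * cmod (deriv f (of_real t * z))"
        unfolding norm_mult using z by (intro mult_right_mono) auto
      also have "\<dots> \<le> M * (1 - cmod (of_real t * z)) powr (- \<alpha>)"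
        using bnd[OF tz[of t]] t s by simp
      also have "\<dots> \<le> M * (1 - t) powr (- \<alpha>)"
      proof (intro mult_left_mono powr_mono2' M)
        show "1 - t \<le> 1 - cmod (of_real t * z)"
          using t s z by (simp add: norm_mult mult_left_le)
      qed (use al t in auto)
      finally show "norm (z * deriv f (of_real t * z)) \<le> M * (1 - t) powr (- \<alpha>)" .
    qed
    then show ?thesis using al by (simp add: \<omega>_def)
  qed
  show ?thesis unfolding uniformly_continuous_on_def
  proof (intro allI impI)
    fix e :: real assume e: "e > 0"
    have "(\<omega> \<longlongrightarrow> M * (1 - 1) powr (1 - \<alpha>) / (1 - \<alpha>)) (at_left 1)"
      unfolding \<omega>_def using al
      by (intro tendsto_intros tendsto_powr') (auto intro: eventually_mono[OF eventually_at_left_real[of 0]])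
    then have "eventually (\<lambda>s. \<omega> s < e / 3) (at_left 1)"
      using e by (intro order_tendstoD) auto
    moreover have "eventually (\<lambda>s::real. 0 < s \<and> s < 1) (at_left 1)"
      by (auto simp: eventually_at_left_field intro: exI[of _ 0])
    ultimately have "eventually (\<lambda>s. \<omega> s < e / 3 \<and> 0 < s \<and> s < 1) (at_left 1)"
      by eventually_elim auto
    then obtain s where s: "\<omega> s < e / 3" "0 < s" "s < 1"
      using eventually_happens'[OF trivial_limit_at_left_real] by blast
    have "uniformly_continuous_on (cball 0 s) f"
      using s by (intro compact_uniformly_continuous holomorphic_on_imp_continuous_on
          holomorphic_on_subset[OF hol]) auto
    then obtain d where d: "d > 0"
      "\<And>x y. x \<in> cball 0 s \<Longrightarrow> y \<in> cball 0 s \<Longrightarrow> dist y x < d \<Longrightarrow> dist (f y) (f x) < e / 3"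
      unfolding uniformly_continuous_on_def using e by (metis zero_less_divide_iff zero_less_numeral)
    show "\<exists>d>0. \<forall>x\<in>ball 0 1. \<forall>x'\<in>ball 0 1. dist x' x < d \<longrightarrow> dist (f x') (f x) < e"
    proof (intro exI[of _ d] conjI d(1) ballI impI)
      fix x y :: complex assume xy: "x \<in> ball 0 1" "y \<in> ball 0 1" "dist y x < d"
      have in_s: "of_real s * u \<in> cball 0 s" if "u \<in> ball 0 1" for u :: complex
        using that s by (simp add: norm_mult mult_left_le)
      have "dist (of_real s * y) (of_real s * x) = s * dist y x"
        using s by (simp add: dist_norm norm_mult flip: right_diff_distrib)
      also have "\<dots> \<le> dist y x" using s by (simp add: mult_left_le_one_le)
      finally have "dist (f (of_real s * y)) (f (of_real s * x)) < e / 3"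
        using d(2)[OF in_s in_s] xy by simp
      moreover have "dist (f x) (f (of_real s * x)) < e / 3" "dist (f y) (f (of_real s * y)) < e / 3"
        using radial[of x s] radial[of y s] xy s by (auto simp: dist_norm)
      ultimately show "dist (f y) (f x) < e"
        using dist_triangle[of "f y" "f x" "f (of_real s * y)"]
          dist_triangle[of "f (of_real s * y)" "f x" "f (of_real s * x)"]
        by (simp add: dist_commute)
    qed
  qed
qed

text \<open>Under \<open>exp (\<i> * w)\<close> a point at height \<open>y\<close> goes to modulus
  \<open>exp (- y)\<close>. These bounds translate heights in the half-plane into distances from the
  circle.\<close>

lemma one_minus_exp_bounds:
  fixes y :: real
  assumes "0 < y" "y \<le> 1 / 2"
  shows "y \<le> 1 - (exp (- y))\<^sup>2" "1 - (exp (- y))\<^sup>2 \<le> 2 * y" "1 - exp (- y) \<le> y"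
proof -
  have e: "(exp (- y))\<^sup>2 = exp (- (2 * y))"
    by (simp add: power2_eq_square flip: exp_add)
  show "1 - (exp (- y))\<^sup>2 \<le> 2 * y" "1 - exp (- y) \<le> y"
    unfolding e using exp_ge_add_one_self[of "- (2 * y)"] exp_ge_add_one_self[of "- y"] by auto
  have "exp (- (2 * y)) = 1 / exp (2 * y)" by (simp add: exp_minus inverse_eq_divide)
  also have "\<dots> \<le> 1 / (1 + 2 * y)"
    using assms exp_ge_add_one_self[of "2 * y"] by (intro divide_left_mono) auto
  also have "\<dots> \<le> 1 - y"
    using assms mult_mono[of y "1/2" "2 * y" "2 * y"] by (simp add: field_simps)
  finally show "y \<le> 1 - (exp (- y))\<^sup>2" unfolding e by simp
qed

lemma tendsto_norm_if_distortion_ge_exponent_lt_1: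
  assumes hol: "\<phi> holomorphic_on ball 0 1" and maps: "\<phi> ` ball 0 1 \<subseteq> ball 0 1"
    and al: "0 < \<alpha>" "\<alpha> < 1" and c: "c > 0"
    and bdd: "bounded (hyp_distortion \<phi> \<alpha> ` ball 0 1)"
    and AE: "AE t in lebesgue_on {0..2*pi}. angular_liminf_ge (hyp_distortion \<phi> \<alpha>) (cis t) c"
  shows "((\<lambda>z. cmod (\<phi> z)) \<longlongrightarrow> 1) at_unit_circle"
proof (rule ccontr)
  assume nlim: "\<not> ?thesis"
  obtain N where N: "negligible N"
    "\<And>t. t \<in> {0..2*pi} \<Longrightarrow> t \<notin> N \<Longrightarrow> angular_liminf_ge (hyp_distortion \<phi> \<alpha>) (cis t) c"
    using AE_lebesgue_on_negligible[OF AE] by auto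
  have \<phi>1: "cmod (\<phi> z) < 1" if "cmod z < 1" for z
    using maps that by (auto simp: image_subset_iff)
  have pos: "1 - (cmod z)\<^sup>2 > 0" "1 - (cmod (\<phi> z))\<^sup>2 > 0" if "cmod z < 1" for z
    using that \<phi>1[OF that] by (auto simp: abs_square_less_1)
  obtain M where M: "M > 0" "\<And>z. cmod z < 1 \<Longrightarrow> hyp_distortion \<phi> \<alpha> z \<le> M"
    using bdd unfolding bounded_pos by (auto simp: abs_le_iff)
  have upper: "cmod (deriv \<phi> z) \<le> M * (1 - (cmod z)\<^sup>2) powr (- \<alpha>)" if z: "cmod z < 1" for z
  proof -
    have "(1 - (cmod z)\<^sup>2) powr \<alpha> * cmod (deriv \<phi> z) \<le> M * (1 - (cmod (\<phi> z))\<^sup>2) powr \<alpha>"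
      using M(2)[OF z] pos[OF z] by (simp add: hyp_distortion_def field_simps)
    also have "\<dots> \<le> M * 1"
      using M(1) pos[OF z] al powr_mono2[of \<alpha> "1 - (cmod (\<phi> z))\<^sup>2" 1] by (intro mult_left_mono) auto
    finally show ?thesis using pos[OF z] by (simp add: powr_minus field_simps)
  qed
  have "uniformly_continuous_on (ball 0 1) \<phi>"
  proof (rule uniformly_continuous_on_disc_if_deriv_bound[OF hol al])
    fix z assume z: "cmod z < 1"
    have "1 - cmod z \<le> 1 - (cmod z)\<^sup>2" using z power_decreasing[of 1 2 "cmod z"] by simp
    then have "M * (1 - (cmod z)\<^sup>2) powr (- \<alpha>) \<le> M * (1 - cmod z) powr (- \<alpha>)"
      using M(1) z al by (intro mult_left_mono powr_mono2') auto
    then show "cmod (deriv \<phi> z) \<le> M * (1 - cmod z) powr (- \<alpha>)"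
      using upper[OF z] by linarith
  qed (use M in auto)
  note uc = this[unfolded uniformly_continuous_on_def, rule_format]
  obtain \<epsilon> where \<epsilon>: "\<epsilon> > 0" "\<not> eventually (\<lambda>z. dist (cmod (\<phi> z)) 1 < \<epsilon>) at_unit_circle"
    using nlim unfolding tendsto_iff by blast
  obtain d where d: "d > 0"
    "\<And>x y. cmod x < 1 \<Longrightarrow> cmod y < 1 \<Longrightarrow> dist y x < d \<Longrightarrow> dist (\<phi> y) (\<phi> x) < \<epsilon> / 2"
    using uc[of "\<epsilon> / 2"] \<epsilon> by (metis half_gt_zero mem_ball_0)
  have "max 0 (1 - d / 4) < 1" using d by simp
  then obtain z0 where z0: "max 0 (1 - d / 4) < cmod z0" "cmod z0 < 1" "\<not> dist (cmod (\<phi> z0)) 1 < \<epsilon>"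
    using \<epsilon>(2) unfolding eventually_at_unit_circle by blast
  have \<phi>z0: "cmod (\<phi> z0) \<le> 1 - \<epsilon>" using z0(3) \<phi>1[OF z0(2)] by (simp add: dist_real_def)
  define s where "s = Arg2pi z0"
  have s: "0 \<le> s" "s < 2 * pi" using Arg2pi[of z0] by (auto simp: s_def)
  have zs: "z0 = of_real (cmod z0) * cis s"
    using Arg2pi[of z0] by (simp add: s_def is_Arg_def cis_conv_exp)
  \<comment> \<open>The arc from \<open>s\<close> to \<open>b\<close> is so short that
    \<open>\<phi>\<close> stays within \<open>\<epsilon> / 2\<close> of \<open>\<phi> z0\<close>
    near it, and it remains in the parameter range where the exceptional set \<open>N\<close> is
    controlled.\<close>
  define b where "b = min (2 * pi) (s + d / 4)"
  have b: "s < b" "b \<le> 2 * pi" "b \<le> s + d / 4" using s d by (auto simp: b_def)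
  have polar: "exp (\<i> * w) = of_real (exp (- Im w)) * cis (Re w)" for w
    by (simp add: exp_eq_polar)
  have npolar: "cmod (exp (\<i> * w)) = exp (- Im w)" for w by simp
  \<comment> \<open>The derivative itself is transplanted to the half-plane, without a chain-rule
    factor.\<close>
  define F where "F w = deriv \<phi> (exp (\<i> * w))" for w
  \<comment> \<open>On the arc's cones \<open>1 - (cmod (\<phi> z))\<^sup>2\<close> is at least
    \<open>\<epsilon> / 2\<close>. Another factor \<open>1/2\<close> is lost in
    \<open>1 - (cmod z)\<^sup>2 \<le> 2 * y\<close>.\<close>
  define k where "k = c / 2 * (\<epsilon> / 4) powr \<alpha>"
  have k: "k > 0" using c \<epsilon> by (simp add: k_def)
  show False
  proof (rule no_blowup_in_almost_all_cones[of F k \<alpha> "1/2" M N s b])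
    have "deriv \<phi> \<circ> (\<lambda>w. exp (\<i> * w)) holomorphic_on {w. Im w > 0}"
      by (rule holomorphic_on_compose_gen[of _ _ _ "ball 0 1"])
         (auto intro!: holomorphic_intros holomorphic_deriv[OF hol])
    then show "F holomorphic_on {w. Im w > 0}" by (simp add: F_def[abs_def] o_def)
  next
    fix w assume w: "0 < Im w" "Im w < 1/2"
    have "cmod (F w) \<le> M * (1 - (exp (- Im w))\<^sup>2) powr (- \<alpha>)"
      unfolding F_def npolar[symmetric] using w by (intro upper) simp
    also have "\<dots> \<le> M * Im w powr (- \<alpha>)"
      using one_minus_exp_bounds(1)[of "Im w"] w M(1) al by (intro mult_left_mono powr_mono2') auto
    finally show "cmod (F w) \<le> M * Im w powr (- \<alpha>)" .
  next
    fix t assume t: "s < t" "t < b" "t \<notin> N"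
    then have "t \<in> {0..2*pi}" using s b by auto
    then obtain \<delta> where \<delta>: "\<delta> > 0"
      "\<And>z. z \<in> angular_region 3 (cis t) \<Longrightarrow> z \<noteq> cis t \<Longrightarrow> dist z (cis t) < \<delta> \<Longrightarrow> c / 2 < hyp_distortion \<phi> \<alpha> z"
      using angular_liminf_geD[OF N(2)[OF _ t(3)], of 3 "c/2"] c by auto
    \<comment> \<open>Cone points satisfy \<open>cmod (z - cis t) \<le> 2 * y\<close>, which is thus
      below \<open>\<delta>\<close> and \<open>d / 4\<close>. The last entry allows
      \<open>one_minus_exp_bounds\<close>.\<close>
    define h where "h = min (\<delta> / 2) (min (d / 8) (1/2))"
    have h: "h > 0" "h \<le> \<delta> / 2" "h \<le> d / 8" "h \<le> 1/2" using \<delta> d by (auto simp: h_def)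
    show "\<exists>\<delta>>0. \<forall>w. 0 < Im w \<and> Im w < \<delta> \<and> \<bar>Re w - t\<bar> \<le> Im w \<longrightarrow> k * Im w powr (- \<alpha>) \<le> cmod (F w)"
    proof (intro exI[of _ h] conjI h(1) allI impI)
      fix w assume w: "0 < Im w \<and> Im w < h \<and> \<bar>Re w - t\<bar> \<le> Im w"
      define z where "z = exp (\<i> * w)"
      define y where "y = Im w"
      have y: "0 < y" "y \<le> 1/2" "y < \<delta> / 2" "y < d / 8" using w h by (auto simp: y_def)
      have nz: "cmod z = exp (- y)" by (simp add: z_def y_def)
      then have z1: "cmod z < 1" using y by simp
      note eb = one_minus_exp_bounds[OF y(1,2)]
      have zp: "z = of_real (exp (- y)) * cis (Re w)" unfolding z_def y_def by (rule polar)
      have dz: "cmod (z - cis t) \<le> 2 * y"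
        unfolding zp using dist_polar_le[of "exp (- y)" "Re w" t] y(1) eb(3) w by (simp add: y_def)
      \<comment> \<open>The distance to \<open>cis t\<close> is at most \<open>2 * y\<close>, and
        \<open>y \<le> 1 - (cmod z)\<^sup>2\<close>, so the image of the cone fits into aperture
        3.\<close>
      have "z \<in> angular_region 3 (cis t)"
        using z1 dz eb(1) y(1) unfolding angular_region_def nz by (simp add: norm_minus_commute nz)
      moreover have "z \<noteq> cis t" using z1 by auto
      moreover have "dist z (cis t) < \<delta>" using dz y by (simp add: dist_norm)
      ultimately have low: "c / 2 < hyp_distortion \<phi> \<alpha> z" using \<delta>(2) by blast
      have "dist z0 (cis s) \<le> d / 4"
        using dist_polar_le[of "cmod z0" s s] z0 by (subst zs) (simp add: dist_norm)
      moreover have "dist (cis s) (cis t) \<le> d / 4"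
        using dist_polar_le[of 1 s t] t b by (simp add: dist_norm)
      moreover have "dist z (cis t) \<le> d / 4" using dz y by (simp add: dist_norm)
      ultimately have "dist z z0 < d"
        using dist_triangle[of z z0 "cis t"] dist_triangle[of "cis t" z0 "cis s"] d(1)
        by (simp add: dist_commute)
      then have "dist (\<phi> z) (\<phi> z0) < \<epsilon> / 2" using d(2) z1 z0(2) by blast
      then have "cmod (\<phi> z) \<le> 1 - \<epsilon> / 2"
        using \<phi>z0 norm_triangle_ineq2[of "\<phi> z" "\<phi> z0"] by (simp add: dist_norm)
      then have "\<epsilon> / 2 \<le> 1 - (cmod (\<phi> z))\<^sup>2"
        using \<phi>1[OF z1] power_decreasing[of 1 2 "cmod (\<phi> z)"] by simp
      then have "(\<epsilon> / 2) powr \<alpha> \<le> (1 - (cmod (\<phi> z))\<^sup>2) powr \<alpha>"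
        using \<epsilon> al by (intro powr_mono2) auto
      then have "c / 2 * (\<epsilon> / 2) powr \<alpha> \<le> c / 2 * (1 - (cmod (\<phi> z))\<^sup>2) powr \<alpha>"
        using c by (intro mult_left_mono) auto
      also have "\<dots> \<le> (1 - (cmod z)\<^sup>2) powr \<alpha> * cmod (deriv \<phi> z)"
        using low pos[OF z1] by (simp add: hyp_distortion_def field_simps)
      also have "\<dots> \<le> (2 * y) powr \<alpha> * cmod (deriv \<phi> z)"
        using eb(1,2) y al unfolding nz by (intro mult_right_mono powr_mono2) auto
      finally have "c / 2 * (\<epsilon> / 2) powr \<alpha> \<le> (2 * y) powr \<alpha> * cmod (deriv \<phi> z)" .
      moreover have "(\<epsilon> / 2) powr \<alpha> = 2 powr \<alpha> * (\<epsilon> / 4) powr \<alpha>"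
        using \<epsilon> by (simp flip: powr_mult)
      moreover have "(2 * y) powr \<alpha> = 2 powr \<alpha> * y powr \<alpha>"
        using y by (simp add: powr_mult)
      ultimately have "2 powr \<alpha> * k \<le> 2 powr \<alpha> * (y powr \<alpha> * cmod (deriv \<phi> z))"
        by (simp add: k_def mult_ac)
      then have "k \<le> y powr \<alpha> * cmod (deriv \<phi> z)" by simp
      then show "k * Im w powr (- \<alpha>) \<le> cmod (F w)"
        using y(1) unfolding F_def z_def[symmetric] y_def[symmetric] by (simp add: powr_minus field_simps)
    qed
  qed (use N k al b in auto)
qed

theorem theorem1:
  fixes \<phi> :: "complex \<Rightarrow> complex"
  assumes "\<phi> holomorphic_on ball 0 1"
    and "\<phi> ` ball 0 1 \<subseteq> ball 0 1"
    and "\<not> (\<exists>w. \<forall>z\<in>ball 0 1. \<phi> z = w)"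
  shows "finite_blaschke \<phi> \<longleftrightarrow>
    (\<exists>\<alpha> c. \<alpha> > 0 \<and> \<alpha> \<noteq> 1 \<and> c > 0 \<and>
       bounded (hyp_distortion \<phi> \<alpha> ` ball 0 1) \<and>
       (AE t in lebesgue_on {0..2*pi}. angular_liminf_ge (hyp_distortion \<phi> \<alpha>) (cis t) c))"
proof
  assume "finite_blaschke \<phi>"
  then obtain c where "c > 0" "bounded (hyp_distortion \<phi> 2 ` ball 0 1)"
      "\<And>t. angular_liminf_ge (hyp_distortion \<phi> 2) (cis t) c"
    using hyp_distortion_if_finite_blaschke[OF assms(1,2)] by blast
  then show "\<exists>\<alpha> c. \<alpha> > 0 \<and> \<alpha> \<noteq> 1 \<and> c > 0 \<and>
       bounded (hyp_distortion \<phi> \<alpha> ` ball 0 1) \<and>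
       (AE t in lebesgue_on {0..2*pi}. angular_liminf_ge (hyp_distortion \<phi> \<alpha>) (cis t) c)"
    by (intro exI[of _ 2] exI[of _ c]) auto
next
  assume "\<exists>\<alpha> c. \<alpha> > 0 \<and> \<alpha> \<noteq> 1 \<and> c > 0 \<and>
       bounded (hyp_distortion \<phi> \<alpha> ` ball 0 1) \<and>
       (AE t in lebesgue_on {0..2*pi}. angular_liminf_ge (hyp_distortion \<phi> \<alpha>) (cis t) c)"
  then obtain \<alpha> c where *: "\<alpha> > 0" "\<alpha> \<noteq> 1" "c > 0" "bounded (hyp_distortion \<phi> \<alpha> ` ball 0 1)"
      "AE t in lebesgue_on {0..2*pi}. angular_liminf_ge (hyp_distortion \<phi> \<alpha>) (cis t) c"
    by blast
  have "((\<lambda>z. cmod (\<phi> z)) \<longlongrightarrow> 1) at_unit_circle"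
  proof (cases "\<alpha> > 1")
    case True
    then show ?thesis using tendsto_norm_if_distortion_ge_exponent_gt_1[OF assms(1,2)] * by blast
  next
    case False
    then have "\<alpha> < 1" using *(2) by simp
    then show ?thesis using tendsto_norm_if_distortion_ge_exponent_lt_1[OF assms(1,2)] * by blast
  qed
  then show "finite_blaschke \<phi>"
    by (rule finite_blaschke_if_tendsto_at_unit_circle[OF assms(1)])
qed

end
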